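(* The following six evaluations hold: \[\sum_{n=1}^\infty \frac{H_n^{(2)}\bar H_n}{n}(-1)^{n-1}=\frac{43}{16}\zeta(4)-\frac14\zeta(2)\ln^2 2-\frac18\ln^4 2-3\,\mathrm{Li}_4\left(\tfrac12\right),\] \[\sum_{n=1}^\infty \frac{H_n^2\bar H_n}{n}(-1)^{n-1}=\frac{53}{16}\zeta(4)+\frac18\ln^4 2+\frac14\zeta(2)\ln^2 2-3\,\mathrm{Li}_4\left(\tfrac12\right),\] \[\sum_{n=1}^\infty \frac{\bar H_n^3}{n}(-1)^{n-1}=5\,\mathrm{Li}_4\left(\tfrac12\right)-\frac{59}{16}\zeta(4)+\frac{13}{4}\zeta(2)\ln^2 2+\frac{11}{24}\ln^4 2,\] \[\sum_{n=1}^\infty \frac{H_n\bar H_n^{(2)}}{n}(-1)^{n-1}=3\,\mathrm{Li}_4\left(\tfrac12\right)+\frac18\ln^4 2-\frac14\zeta(2)\ln^2 2-\frac{9}{16}\zeta(4),\] \[\sum_{n=1}^\infty \frac{H_nH_n^{(2)}}{n}(-1)^{n-1}=2\,\mathrm{Li}_4\left(\tfrac12\right)+\frac1{12}\ln^4 2+\frac78\zeta(3)\ln 2-\frac14\zeta(2)\ln^2 2-\zeta(4),\] \[\sum_{n=1}^\infty \frac{H_n^3}{n}(-1)^{n-1}=\frac58\zeta(4)+\frac34\zeta(2)\ln^2 2-\frac14\ln^4 2-\frac98\zeta(3)\ln 2.\]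
   Context: For positive integers $n,p$: $H_n^{(p)}=\sum_{j=1}^n j^{-p}$, $H_n=H_n^{(1)}$; $\bar H_n^{(p)}=\sum_{j=1}^n (-1)^{j-1}j^{-p}$, $\bar H_n=\bar H_n^{(1)}$. $\zeta$ is the Riemann zeta function and $\mathrm{Li}_p(x)=\sum_{n\ge1}x^n/n^p$. The infinite sums are limits of partial sums (they may converge only conditionally). *)

theory Defs
  imports "HOL-Analysis.Analysis"
begin

(* In both definitions the order p comes first: "gen_harm p n" is H_n^(p),
   and H_n is "gen_harm 1 n". *)
definition gen_harm :: "nat \<Rightarrow> nat \<Rightarrow> real" where
  "gen_harm p n = (\<Sum>j=1..n. 1 / real j ^ p)"

definition alt_harm :: "nat \<Rightarrow> nat \<Rightarrow> real" where
  "alt_harm p n = (\<Sum>j=1..n. (-1) ^ (j - 1) / real j ^ p)"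

(* The Riemann zeta function on the real half-line s > 1, where it is given by its
   Dirichlet series; for s \<le> 1 the value below is meaningless. *)
definition zeta :: "real \<Rightarrow> real" where
  "zeta s = (\<Sum>n. 1 / real (Suc n) powr s)"

(* Meaningful only where the series converges, in particular for \<bar>x\<bar> < 1. *)
definition polylog :: "nat \<Rightarrow> real \<Rightarrow> real" where
  "polylog p x = (\<Sum>n. x ^ Suc n / real (Suc n) ^ p)"

end

(* All six sums are linear combinations of alternating nested sums of weight 4. Such a nested sum is also
   the value at 1 of an iterated integral in the forms dx/x, dx/(1-x), dx/(1+x). The product of two
   nested sums expands by the stuffle product (splitting the summation range), the product of two
   iterated integrals by the shuffle product (integration by parts), and comparing both expansions
   gives linear relations. Comparing also the two products with the divergent harmonic series, and
   adding the distribution relation for the alternating zeta values, every value of weight 4 needed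
   here is expressed by zeta(4), zeta(3) ln 2, zeta(2) ln(2)^2, ln(2)^4 and one remaining value,
   which is replaced by Li_4(1/2) through the substitution x -> x/(1+x). *)
theory Submission
  imports Defs
begin

section \<open>Iterated integrals and the shuffle product\<close>

text \<open>At 1 a word starting with -1 may converge only conditionally, so series are never
  multiplied there. The shuffle product is an identity of formal power series, carried to 1 by
  Abel's theorem; the stuffle product is an identity of partial sums, carried to the limit. Both end
  at the same numbers \<open>iter_val\<close>, because the partial sums of the coefficients of a
  word are, up to a sign, truncated nested sums. For the divergent word \<open>[1]\<close> both
  arguments leave an error: a logarithm, or a harmonic number, times the distance of a convergent
  word from its value. The coefficient bounds are made strong enough to beat it. No evaluation of
  \<open>zeta\<close> at even integers enters; \<open>zeta 2 ^ 2 = 5/2 * zeta 4\<close> falls out of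
  the relations themselves.\<close>

text \<open>Power series coefficients of the iterated integral whose integrands, from the outermost to the
  innermost, are \<open>dx/x\<close> for the letter \<open>0\<close> and \<open>dx/(1 - e x)\<close> for a letter \<open>e \<noteq> 0\<close>. The division by
  \<open>real n\<close> makes the constant coefficient of a nonempty word \<open>0\<close>; for the word \<open>[0]\<close>, whose integral
  diverges, this is a junk value, so words ending in \<open>0\<close> are excluded below.\<close>

primrec iter_coef :: "real list \<Rightarrow> nat \<Rightarrow> real" where
  "iter_coef [] n = (if n = 0 then 1 else 0)"
| "iter_coef (e # w) n =
     (if e = 0 then iter_coef w n else (\<Sum>m<n. e ^ (n - Suc m) * iter_coef w m)) / real n"

definition iter_fps :: "real list \<Rightarrow> real fps" where
  "iter_fps w = Abs_fps (iter_coef w)"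

definition iter_val :: "real list \<Rightarrow> real" where
  "iter_val w = (\<Sum>n. iter_coef w n)"

lemma iter_coef_Cons_0 [simp]: "iter_coef (e # w) 0 = 0"
  by simp

lemma iter_fps_nth [simp]: "fps_nth (iter_fps w) n = iter_coef w n"
  by (simp add: iter_fps_def)

lemma iter_fps_Nil: "iter_fps [] = 1"
  by (rule fps_ext) (simp)

text \<open>The operator \<open>x d/dx\<close> multiplies the n-th coefficient by n and so undoes
  the division by \<open>real n\<close>, except at n = 0; a nonempty word has constant coefficient
  0, so nothing is lost there.\<close>

lemma iter_fps_deriv_0:
  assumes "w \<noteq> []"
  shows "fps_X * fps_deriv (iter_fps (0 # w)) = iter_fps w"
proof -
  obtain e u where w: "w = e # u" using assms by (cases w) auto
  show ?thesis
    by (rule fps_ext) (auto simp: w fps_X_mult_nth)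
qed

text \<open>The sum in \<open>iter_coef\<close> is the Cauchy product with the geometric series of
  \<open>1 / (1 - e x)\<close>, which the factor \<open>1 - e x\<close> undoes.\<close>

lemma iter_fps_deriv_nonzero:
  assumes "e \<noteq> 0"
  shows "(1 - fps_const e * fps_X) * fps_deriv (iter_fps (e # w)) = iter_fps w"
proof (rule fps_ext)
  fix n
  have d: "fps_nth (fps_deriv (iter_fps (e # w))) k = (\<Sum>m\<le>k. e ^ (k - m) * iter_coef w m)" for k
    using assms by (simp add: lessThan_Suc_atMost)
  show "fps_nth ((1 - fps_const e * fps_X) * fps_deriv (iter_fps (e # w))) n = fps_nth (iter_fps w) n"
  proof (cases n)
    case 0
    then show ?thesis by (simp add: d left_diff_distrib mult.assoc del: fps_deriv_nth)
  next
    case (Suc k)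
    have "(\<Sum>m\<le>Suc k. e ^ (Suc k - m) * iter_coef w m) = e * (\<Sum>m\<le>k. e ^ (k - m) * iter_coef w m) + iter_coef w (Suc k)"
      by (simp add: sum_distrib_left Suc_diff_le mult.assoc)
    with Suc show ?thesis
      by (simp add: d left_diff_distrib mult.assoc fps_X_mult_nth del: fps_deriv_nth sum.atMost_Suc)
  qed
qed

text \<open>The reciprocal of the integrand; for \<open>dx/x\<close> this is \<open>fps_X\<close>, which is not a unit, so identities
  are proved after multiplying with the kernel.\<close>

definition iter_ker :: "real \<Rightarrow> real fps" where
  "iter_ker e = (if e = 0 then fps_X else 1 - fps_const e * fps_X)"

lemma iter_ker_nonzero: "iter_ker e \<noteq> 0"
proof -
  have "fps_nth (iter_ker e) (if e = 0 then 1 else 0) \<noteq> 0"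
    by (simp add: iter_ker_def)
  then show ?thesis by force
qed

lemma iter_fps_deriv:
  assumes "e = 0 \<Longrightarrow> w \<noteq> []"
  shows "iter_ker e * fps_deriv (iter_fps (e # w)) = iter_fps w"
  using assms iter_fps_deriv_0 iter_fps_deriv_nonzero by (auto simp: iter_ker_def)

text \<open>Multiplicities matter: shuffling \<open>[-1]\<close> with itself yields
  \<open>[-1, -1]\<close> twice, which the set \<open>shuffles\<close> cannot record.\<close>

fun shuffle_list :: "'a list \<Rightarrow> 'a list \<Rightarrow> 'a list list" where
  "shuffle_list [] v = [v]"
| "shuffle_list (e # u) [] = [e # u]"
| "shuffle_list (e # u) (f # v) =
     map ((#) e) (shuffle_list u (f # v)) @ map ((#) f) (shuffle_list (e # u) v)"

lemma shuffle_list_Nil2 [simp]: "shuffle_list u [] = [u]"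
  by (cases u) auto

lemma set_shuffle_list: "set (shuffle_list u v) = shuffles u v"
  by (induction u v rule: shuffle_list.induct) auto

lemma iter_ker_deriv_sum_list:
  assumes "[] \<notin> set ws"
  shows "iter_ker e * fps_deriv (\<Sum>w\<leftarrow>map ((#) e) ws. iter_fps w) = (\<Sum>w\<leftarrow>ws. iter_fps w)"
  using assms
proof (induction ws)
  case (Cons w ws)
  have "iter_ker e * fps_deriv (iter_fps (e # w)) = iter_fps w"
    using Cons.prems by (intro iter_fps_deriv) auto
  with Cons show ?case by (simp add: distrib_left)
qed simp

text \<open>The product rule splits the derivative into two halves; each, multiplied by the kernel
  of its own first letter, becomes a shorter product. Since neither factor ends in 0, the derivative
  rule never meets \<open>[0]\<close>.\<close>

theorem iter_fps_shuffle:
  assumes "u = [] \<or> last u \<noteq> 0" "v = [] \<or> last v \<noteq> 0"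
  shows "iter_fps u * iter_fps v = (\<Sum>w\<leftarrow>shuffle_list u v. iter_fps w)"
  using assms
proof (induction u v rule: shuffle_list.induct)
  case (3 e u f v)
  let ?A = "\<Sum>w\<leftarrow>map ((#) e) (shuffle_list u (f # v)). iter_fps w"
  let ?B = "\<Sum>w\<leftarrow>map ((#) f) (shuffle_list (e # u) v). iter_fps w"
  have "iter_ker e * (fps_deriv (iter_fps (e # u)) * iter_fps (f # v)) = iter_fps u * iter_fps (f # v)"
    using "3.prems" by (subst mult.assoc [symmetric], subst iter_fps_deriv) auto
  also have "\<dots> = (\<Sum>w\<leftarrow>shuffle_list u (f # v). iter_fps w)"
    using "3.prems" by (intro "3.IH") (auto split: if_splits)
  also have "\<dots> = iter_ker e * fps_deriv ?A"
    by (intro iter_ker_deriv_sum_list [symmetric]) (simp add: set_shuffle_list)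
  finally have A: "fps_deriv (iter_fps (e # u)) * iter_fps (f # v) = fps_deriv ?A"
    using iter_ker_nonzero by simp
  have "iter_ker f * (iter_fps (e # u) * fps_deriv (iter_fps (f # v))) = iter_fps (e # u) * iter_fps v"
    using "3.prems" by (subst mult.left_commute, subst iter_fps_deriv) auto
  also have "\<dots> = (\<Sum>w\<leftarrow>shuffle_list (e # u) v. iter_fps w)"
    using "3.prems" by (intro "3.IH") (auto split: if_splits)
  also have "\<dots> = iter_ker f * fps_deriv ?B"
    by (intro iter_ker_deriv_sum_list [symmetric]) (simp add: set_shuffle_list)
  finally have B: "iter_fps (e # u) * fps_deriv (iter_fps (f # v)) = fps_deriv ?B"
    using iter_ker_nonzero by simp
  have "fps_deriv (iter_fps (e # u) * iter_fps (f # v)) = fps_deriv (?A + ?B)"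
    using A B by simp
  \<comment> \<open>All words here are nonempty, so there is no constant of integration.\<close>
  moreover have "fps_nth (\<Sum>w\<leftarrow>map ((#) g) ws. iter_fps w) 0 = 0" for g ws
    by (induction ws) auto
  ultimately have "iter_fps (e # u) * iter_fps (f # v) = ?A + ?B"
    by (subst (asm) fps_deriv_eq_iff) simp
  then show ?case by simp
qed (simp_all add: iter_fps_Nil)

section \<open>Growth of the coefficients and convergence\<close>

text \<open>A nonzero letter sums coefficients of size \<open>(1 + harm m) ^ k / m\<close>, which
  costs one more factor \<open>harm n\<close>. The summand 1 pays for the term m = 0 and keeps the
  base at least 1, so the exponent may also be raised for a letter 0.\<close>

lemma iter_coef_bound:
  assumes "set w \<subseteq> {-1..1}"
  shows "\<bar>iter_coef w n\<bar> * real n \<le> (1 + harm n) ^ length w"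
  using assms
proof (induction w arbitrary: n)
  case (Cons e w)
  have e: "\<bar>e\<bar> \<le> 1" using Cons.prems by auto
  have IH: "\<bar>iter_coef w n\<bar> * real n \<le> (1 + harm n) ^ length w" for n
    using Cons by auto
  have h0: "harm n \<ge> (0::real)" for n by (rule harm_nonneg)
  show ?case
  proof (cases "n = 0")
    case False
    have "\<bar>\<Sum>m<n. e ^ (n - Suc m) * iter_coef w m\<bar> \<le> (1 + harm n) ^ Suc (length w)"
    proof -
      have 1: "\<bar>e ^ (n - Suc m) * iter_coef w m\<bar> \<le> (if m = 0 then 1 else (1 + harm n) ^ length w / real m)"
        if "m < n" for m
      proof -
        have "\<bar>e ^ (n - Suc m) * iter_coef w m\<bar> \<le> 1 * \<bar>iter_coef w m\<bar>"
          unfolding abs_mult power_abs using e by (intro mult_right_mono power_le_one) auto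
        also have "\<dots> \<le> (if m = 0 then 1 else (1 + harm n) ^ length w / real m)"
        proof (cases "m = 0")
          case True
          then show ?thesis by (cases w) auto
        next
          case False
          have "\<bar>iter_coef w m\<bar> * real m \<le> (1 + harm m) ^ length w" by (rule IH)
          also have "\<dots> \<le> (1 + harm n) ^ length w"
            using that h0[of m] harm_mono[of m n, where ?'a = real] by (intro power_mono) auto
          finally show ?thesis using False by (simp add: field_simps)
        qed
        finally show ?thesis .
      qed
      have "\<bar>\<Sum>m<n. e ^ (n - Suc m) * iter_coef w m\<bar> \<le> (\<Sum>m<n. if m = 0 then 1 else (1 + harm n) ^ length w / real m)"
        by (rule order_trans[OF sum_abs sum_mono]) (use 1 in auto)
      also have "\<dots> = 1 + (\<Sum>m\<in>{1..<n}. (1 + harm n) ^ length w / real m)"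
      proof -
        have "{..<n} = insert 0 {1..<n}" using False by auto
        then show ?thesis by (simp cong: sum.cong_simp)
      qed
      also have "(\<Sum>m\<in>{1..<n}. (1 + harm n) ^ length w / real m) \<le> (\<Sum>m\<in>{1..n}. (1 + harm n) ^ length w / real m)"
        using h0[of n] by (intro sum_mono2) auto
      also have "\<dots> = (1 + harm n) ^ length w * harm n"
        by (simp add: harm_def sum_distrib_left divide_inverse)
      also have "1 + \<dots> \<le> (1 + harm n) ^ length w + (1 + harm n) ^ length w * harm n"
        using h0[of n] by (intro add_right_mono one_le_power) auto
      finally show ?thesis by (simp add: algebra_simps)
    qed
    moreover have "\<bar>iter_coef w n\<bar> \<le> (1 + harm n) ^ Suc (length w)"
    proof -
      have "\<bar>iter_coef w n\<bar> * 1 \<le> \<bar>iter_coef w n\<bar> * real n"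
        using False by (intro mult_left_mono) auto
      also have "\<dots> \<le> (1 + harm n) ^ length w" by (rule IH)
      also have "\<dots> \<le> (1 + harm n) ^ Suc (length w)"
        using h0[of n] by (intro power_increasing) auto
      finally show ?thesis by simp
    qed
    ultimately show ?thesis using False by (auto simp: abs_mult)
  qed (simp add: harm_def)
qed auto

text \<open>\<open>harm n\<close> is at most 1 + ln n, and ln n is at most
  \<open>n powr \<delta> / \<delta>\<close>; this is where the constant
  \<open>2 + 1 / \<delta>\<close> comes from.\<close>

lemma harm_power_bound:
  assumes "\<epsilon> > 0"
  obtains K where "K > 0" "\<And>n. n > 0 \<Longrightarrow> (1 + harm n) ^ k \<le> K * real n powr \<epsilon>"
proof
  \<comment> \<open>Dividing by k + 1 keeps \<delta> meaningful for k = 0 and still gives \<delta> k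
    \<le> \<epsilon>.\<close>
  define \<delta> where "\<delta> = \<epsilon> / real (Suc k)"
  have \<delta>: "\<delta> > 0" using assms by (simp add: \<delta>_def)
  show "(2 + 1 / \<delta>) ^ k > 0" using \<delta> by (intro zero_less_power add_pos_pos) auto
  fix n :: nat
  assume n: "n > 0"
  then obtain m where m: "n = Suc m" by (cases n) auto
  have "harm n - ln (real n) \<le> (1 :: real)"
    using decseqD[OF decseq_harm_diff_ln, of 0 m] by (simp add: m harm_expand)
  moreover have "ln (real n) \<le> real n powr \<delta> / \<delta>"
    using n \<delta> by (intro ln_powr_bound) auto
  moreover have "1 \<le> real n powr \<delta>"
    using n \<delta> by (intro ge_one_powr_ge_zero) auto
  ultimately have "1 + harm n \<le> (2 + 1 / \<delta>) * real n powr \<delta>"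
    by (simp add: algebra_simps)
  then have "(1 + harm n) ^ k \<le> ((2 + 1 / \<delta>) * real n powr \<delta>) ^ k"
    by (intro power_mono) (auto intro: add_nonneg_nonneg harm_nonneg)
  also have "\<dots> = (2 + 1 / \<delta>) ^ k * real n powr (\<delta> * real k)"
    using n by (simp add: power_mult_distrib powr_realpow [symmetric] powr_powr)
  also have "\<dots> \<le> (2 + 1 / \<delta>) ^ k * real n powr \<epsilon>"
    using n \<delta> assms by (intro mult_left_mono powr_mono) (auto simp: \<delta>_def field_simps)
  finally show "(1 + harm n) ^ k \<le> (2 + 1 / \<delta>) ^ k * real n powr \<epsilon>" .
qed

lemma iter_coef_powr_bound:
  assumes "set w \<subseteq> {-1..1}" "\<epsilon> > 0"
  obtains K where "K > 0" "\<And>n. n > 0 \<Longrightarrow> \<bar>iter_coef w n\<bar> \<le> K * real n powr (\<epsilon> - 1)"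
proof -
  obtain K where K: "K > 0" "\<And>n. n > 0 \<Longrightarrow> (1 + harm n) ^ length w \<le> K * real n powr \<epsilon>"
    using harm_power_bound[OF assms(2)] by blast
  show ?thesis
  proof (rule that[OF K(1)])
    fix n :: nat assume n: "n > 0"
    then have "\<bar>iter_coef w n\<bar> * real n \<le> K * real n powr \<epsilon>"
      using iter_coef_bound[OF assms(1), of n] K(2)[of n] by linarith
    then show "\<bar>iter_coef w n\<bar> \<le> K * real n powr (\<epsilon> - 1)"
      using n by (simp add: powr_diff field_simps)
  qed
qed

text \<open>An outermost 0 divides by n once more, so for \<epsilon> < 1 the series converges
  absolutely. The bound includes n = 0, where both sides are 0.\<close>

lemma iter_coef_0_powr_bound:
  assumes "set w \<subseteq> {-1..1}" "\<epsilon> > 0"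
  obtains K where "K > 0" "\<And>n. \<bar>iter_coef (0 # w) n\<bar> \<le> K * real n powr (\<epsilon> - 2)"
proof -
  obtain K where K: "K > 0" "\<And>n. n > 0 \<Longrightarrow> \<bar>iter_coef w n\<bar> \<le> K * real n powr (\<epsilon> - 1)"
    using iter_coef_powr_bound[OF assms] by blast
  show ?thesis
  proof (rule that[OF K(1)])
    fix n :: nat
    show "\<bar>iter_coef (0 # w) n\<bar> \<le> K * real n powr (\<epsilon> - 2)"
    proof (cases "n = 0")
      case False
      then have "\<bar>iter_coef w n\<bar> / real n \<le> K * real n powr (\<epsilon> - 1) / real n"
        using K(2) by (intro divide_right_mono) auto
      with False show ?thesis by (simp add: powr_diff field_simps power2_eq_square)
    qed simp
  qed
qed

section \<open>Convergence of the coefficient series\<close>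

lemma summable_powr_bounded:
  fixes f :: "nat \<Rightarrow> real"
  assumes "\<And>n. \<bar>f n\<bar> \<le> K * real n powr s" "s < -1"
  shows "summable f"
proof (rule summable_comparison_test')
  show "summable (\<lambda>n. K * real n powr s)"
    using assms(2) by (intro summable_mult) (simp add: summable_real_powr_iff)
  show "norm (f n) \<le> K * real n powr s" for n
    using assms(1) by simp
qed

text \<open>\<open>(-1)\<^sup>n g(n)\<close> telescopes up to the differences of \<open>g\<close>, so bounded variation replaces the
  monotonicity of the Leibniz criterion.\<close>

lemma summable_alternating:
  fixes g :: "nat \<Rightarrow> real"
  assumes g: "g \<longlonglongrightarrow> 0" and s: "summable (\<lambda>n. \<bar>g (Suc n) - g n\<bar>)"
  shows "summable (\<lambda>n. (-1) ^ n * g n)"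
proof -
  have eq: "(\<Sum>n<N. (-1) ^ n * g n) =
      (g 0 - (-1) ^ N * g N + (\<Sum>n<N. (-1) ^ n * (g n - g (Suc n)))) / 2" for N
    by (induction N) (simp_all add: field_simps)
  have "summable (\<lambda>n. (-1) ^ n * (g n - g (Suc n)))"
    by (rule summable_rabs_cancel) (use s in \<open>simp add: abs_mult abs_minus_commute\<close>)
  then obtain l where "(\<lambda>N. \<Sum>n<N. (-1) ^ n * (g n - g (Suc n))) \<longlonglongrightarrow> l"
    by (auto simp: summable_def sums_def)
  moreover have "(\<lambda>N. (-1) ^ N * g N) \<longlonglongrightarrow> 0"
    using g by (subst tendsto_rabs_zero_iff [symmetric]) (simp add: abs_mult tendsto_rabs_zero_iff)
  ultimately have "(\<lambda>N. \<Sum>n<N. (-1) ^ n * g n) \<longlonglongrightarrow> (g 0 - 0 + l) / 2"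
    unfolding eq by (intro tendsto_intros) auto
  then show ?thesis by (auto simp: summable_def sums_def)
qed

lemma summable_iter_coef_0:
  assumes "set w \<subseteq> {-1..1}"
  shows "summable (iter_coef (0 # w))"
proof -
  obtain K where "\<And>n. \<bar>iter_coef (0 # w) n\<bar> \<le> K * real n powr (1 / 2 - 2)"
    using iter_coef_0_powr_bound[OF assms, of "1/2"] by auto
  then show ?thesis by (rule summable_powr_bounded) simp
qed

text \<open>Up to the sign \<open>- ((-1) ^ n)\<close> the coefficient is the mean
  \<open>g n = S n / n\<close> of the signed coefficients of w. The increment of a mean is (new term
  - old mean) / (n + 1), here of order \<open>n powr (-3/2)\<close>, so g has bounded
  variation.\<close>

lemma summable_iter_coef_neg1:
  assumes "set w \<subseteq> {-1..1}"
  shows "summable (iter_coef (-1 # w))"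
proof -
  define S where "S n = (\<Sum>m<n. (-1) ^ m * iter_coef w m)" for n
  define g where "g n = S n / real n" for n
  have eq: "iter_coef (-1 # w) n = - ((-1) ^ n * g n)" for n
  proof -
    have "(\<Sum>m<n. (-1) ^ (n - Suc m) * iter_coef w m) = (\<Sum>m<n. - ((-1) ^ n * ((-1) ^ m * iter_coef w m)))"
    proof (intro sum.cong refl)
      fix m assume "m \<in> {..<n}"
      \<comment> \<open>\<open>Suc m + m\<close> is odd, so adding it to the exponent flips the
        sign.\<close>
      have "(-1::real) ^ (n - Suc m) = - ((-1) ^ (n - Suc m + Suc m + m))"
        by (simp add: power_add mult.assoc flip: power_mult_distrib)
      also have "n - Suc m + Suc m + m = n + m" using \<open>m \<in> {..<n}\<close> by simp
      finally have *: "(-1::real) ^ (n - Suc m) = - ((-1) ^ (n + m))" .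
      show "(-1) ^ (n - Suc m) * iter_coef w m = - ((-1) ^ n * ((-1) ^ m * iter_coef w m))"
        unfolding * by (simp add: power_add mult.assoc)
    qed
    also have "\<dots> = - ((-1) ^ n * S n)"
      by (simp add: S_def sum_distrib_left sum_negf)
    finally show ?thesis by (simp add: g_def)
  qed
  \<comment> \<open>The growth bound for the longer word thus bounds g itself.\<close>
  have absg: "\<bar>g n\<bar> = \<bar>iter_coef (-1 # w) n\<bar>" for n
    unfolding eq by (simp add: abs_mult)
  obtain K where K: "K > 0" "\<And>n. n > 0 \<Longrightarrow> \<bar>iter_coef w n\<bar> \<le> K * real n powr (1 / 2 - 1)"
    using iter_coef_powr_bound[OF assms, of "1/2"] by auto
  have "set (-1 # w) \<subseteq> {-1..1}" using assms by auto
  from iter_coef_powr_bound[OF this, of "1/2"]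
  obtain K' where K': "K' > 0" "\<And>n. n > 0 \<Longrightarrow> \<bar>g n\<bar> \<le> K' * real n powr (1 / 2 - 1)"
    unfolding absg by auto
  have "g \<longlonglongrightarrow> 0"
  proof (rule Lim_null_comparison)
    show "\<forall>\<^sub>F n in sequentially. norm (g n) \<le> K' * real n powr (1 / 2 - 1)"
      using eventually_gt_at_top[of 0] by eventually_elim (use K' in auto)
    show "(\<lambda>n. K' * real n powr (1 / 2 - 1)) \<longlonglongrightarrow> 0"
      by (intro tendsto_mult_right_zero tendsto_neg_powr filterlim_real_sequentially) auto
  qed
  moreover have "summable (\<lambda>n. \<bar>g (Suc n) - g n\<bar>)"
  proof (rule summable_comparison_test_ev)
    show "summable (\<lambda>n. (K + K') * real n powr (-3/2))"
      by (intro summable_mult) (simp add: summable_real_powr_iff)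
    show "\<forall>\<^sub>F n in sequentially. norm \<bar>g (Suc n) - g n\<bar> \<le> (K + K') * real n powr (-3/2)"
      using eventually_gt_at_top[of 0]
    proof eventually_elim
      case (elim n)
      have "g (Suc n) - g n = ((-1) ^ n * iter_coef w n - g n) / real (Suc n)"
        using elim by (simp add: g_def S_def field_simps)
      then have "\<bar>g (Suc n) - g n\<bar> = \<bar>(-1) ^ n * iter_coef w n - g n\<bar> / real (Suc n)"
        by (simp add: abs_mult)
      also have "\<dots> \<le> (\<bar>iter_coef w n\<bar> + \<bar>g n\<bar>) / real n"
        using elim abs_triangle_ineq4[of "(-1) ^ n * iter_coef w n" "g n"]
        by (intro frac_le) (auto simp: abs_mult)
      also have "\<dots> \<le> (K * real n powr (1 / 2 - 1) + K' * real n powr (1 / 2 - 1)) / real n"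
        using K(2)[OF elim] K'(2)[OF elim] by (intro divide_right_mono add_mono) auto
      also have "\<dots> = (K + K') * (real n powr (-1/2) / real n powr 1)"
        using elim by (simp add: field_simps)
      also have "\<dots> = (K + K') * real n powr (-3/2)"
        by (subst powr_diff [symmetric]) simp
      finally show ?case by simp
    qed
  qed
  ultimately have "summable (\<lambda>n. - ((-1) ^ n * g n))"
    by (intro summable_minus summable_alternating)
  then show ?thesis unfolding eq [symmetric] .
qed

text \<open>The integral converges at both ends: a first letter 1 would be singular at 1, a last
  letter 0 at 0.\<close>

definition admissible :: "real list \<Rightarrow> bool" where
  "admissible w \<longleftrightarrow> w \<noteq> [] \<and> hd w \<in> {0, -1} \<and> last w \<noteq> 0 \<and> set w \<subseteq> {-1..1}"

lemma iter_coef_sums: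
  assumes "admissible w"
  shows "iter_coef w sums iter_val w"
proof (cases w)
  case (Cons e u)
  then have "summable (iter_coef w)"
    using assms summable_iter_coef_0[of u] summable_iter_coef_neg1[of u]
    by (auto simp: admissible_def)
  then show ?thesis by (simp add: iter_val_def summable_sums)
qed (use assms in \<open>auto simp: admissible_def\<close>)

lemma admissible_shuffle:
  assumes "admissible u" "admissible v" "w \<in> set (shuffle_list u v)"
  shows "admissible w"
proof -
  have nz: "last w \<noteq> 0" if "w \<in> shuffles u v" "u \<noteq> []" "v \<noteq> []" "last u \<noteq> 0" "last v \<noteq> 0" for w u v :: "real list"
    using that
  proof (induction u v arbitrary: w rule: shuffles.induct)
    case (3 x xs y ys)
    from "3.prems" consider z where "w = x # z" "z \<in> shuffles xs (y # ys)"
      | z where "w = y # z" "z \<in> shuffles (x # xs) ys" by auto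
    then show ?case
    proof cases
      case 1
      then have "z \<noteq> []" by auto
      with 1 show ?thesis using "3.IH"(1)[of z] "3.prems" by (cases "xs = []") auto
    next
      case 2
      then have "z \<noteq> []" by auto
      with 2 show ?thesis using "3.IH"(2)[of z] "3.prems" by (cases "ys = []") auto
    qed
  qed auto
  have w: "w \<in> shuffles u v" using assms(3) by (simp add: set_shuffle_list)
  obtain e u' f v' where uv: "u = e # u'" "v = f # v'"
    using assms(1,2) by (cases u; cases v) (auto simp: admissible_def)
  have "w \<noteq> []" "hd w \<in> {e, f}" using w by (auto simp: uv)
  moreover have "set w = set u \<union> set v" using w by (rule set_shuffles)
  moreover have "last w \<noteq> 0" using assms w by (intro nz[of w u v]) (auto simp: admissible_def)
  ultimately show ?thesis using assms unfolding admissible_def uv by auto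
qed

section \<open>Values at 1\<close>

text \<open>Abel's theorem by summation by parts: the deviation from s is (1 - x) times the power
  series of the errors \<open>e n\<close> of the partial sums. The factor 1 - x kills the finitely
  many large errors, and the small ones contribute at most \<epsilon>/2.\<close>

lemma abel_limit:
  fixes c :: "nat \<Rightarrow> real"
  assumes "c sums s"
  shows "((\<lambda>x. \<Sum>n. c n * x ^ n) \<longlongrightarrow> s) (at_left 1)"
proof -
  define e where "e n = (\<Sum>k\<le>n. c k) - s" for n
  have e0: "e \<longlonglongrightarrow> 0"
    using assms unfolding e_def sums_def_le by (simp add: LIM_zero)
  then have "Bseq e" by (intro convergent_imp_Bseq) (auto simp: convergent_def)
  then obtain B where B: "B > 0" "\<And>n. \<bar>e n\<bar> \<le> B" by (auto elim!: BseqE)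
  have sme: "summable (\<lambda>n. \<bar>e n\<bar> * x ^ n)" if "0 < x" "x < 1" for x
  proof (rule summable_comparison_test')
    show "summable (\<lambda>n. B * x ^ n)" using that by (intro summable_mult summable_geometric) auto
    show "norm (\<bar>e n\<bar> * x ^ n) \<le> B * x ^ n" for n
      using that B by (auto simp: abs_mult intro!: mult_right_mono)
  qed
  have sme': "summable (\<lambda>n. e n * x ^ n)" if "0 < x" "x < 1" for x
    by (rule summable_rabs_cancel) (use sme[OF that] that in \<open>simp add: abs_mult\<close>)
  have eq: "(\<Sum>n. c n * x ^ n) - s = (1 - x) * (\<Sum>n. e n * x ^ n)" if x: "0 < x" "x < 1" for x
  proof -
    have "(\<lambda>n. e n * x ^ n) sums (\<Sum>n. e n * x ^ n)"
      using sme'[OF x] by (rule summable_sums)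
    \<comment> \<open>The errors shifted by one place, with -s as the error of the empty sum; the
      difference of consecutive errors is \<open>c n\<close>.\<close>
    moreover have "(\<lambda>n. (case n of 0 \<Rightarrow> - s | Suc m \<Rightarrow> e m * x ^ n)) sums (x * (\<Sum>n. e n * x ^ n) - s)"
      using sums_Suc[of "\<lambda>n. (case n of 0 \<Rightarrow> - s | Suc m \<Rightarrow> e m * x ^ n)"]
        sums_mult[OF summable_sums[OF sme'[OF x]], of x] by (simp add: mult_ac)
    ultimately have "(\<lambda>n. e n * x ^ n - (case n of 0 \<Rightarrow> - s | Suc m \<Rightarrow> e m * x ^ n)) sums
       ((\<Sum>n. e n * x ^ n) - (x * (\<Sum>n. e n * x ^ n) - s))" by (rule sums_diff)
    also have "(\<lambda>n. e n * x ^ n - (case n of 0 \<Rightarrow> - s | Suc m \<Rightarrow> e m * x ^ n)) = (\<lambda>n. c n * x ^ n)"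
      by (rule ext) (auto simp: e_def algebra_simps split: nat.splits)
    finally show ?thesis by (simp add: sums_iff algebra_simps)
  qed
  have "((\<lambda>x. (1 - x) * (\<Sum>n. e n * x ^ n)) \<longlongrightarrow> 0) (at_left 1)"
  proof (rule tendstoI)
    fix \<epsilon> :: real assume \<epsilon>: "\<epsilon> > 0"
    obtain N where N: "\<And>n. n \<ge> N \<Longrightarrow> \<bar>e n\<bar> < \<epsilon> / 2"
      using LIMSEQ_D[OF e0, of "\<epsilon> / 2"] \<epsilon> by auto
    have "((\<lambda>x. (1 - x) * (real N * B)) \<longlongrightarrow> (1 - 1) * (real N * B)) (at_left 1)"
      by (intro tendsto_intros)
    then have "\<forall>\<^sub>F x in at_left 1. (1 - x) * (real N * B) < \<epsilon> / 2"
      using \<epsilon> by (intro order_tendstoD(2)) auto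
    moreover have "\<forall>\<^sub>F x in at_left (1::real). 0 < x \<and> x < 1"
      by (rule eventually_mono[OF eventually_at_left_real[of 0 1]]) auto
    ultimately show "\<forall>\<^sub>F x in at_left 1. dist ((1 - x) * (\<Sum>n. e n * x ^ n)) 0 < \<epsilon>"
    proof eventually_elim
      case (elim x)
      have g: "(\<lambda>n. x ^ n) sums (1 / (1 - x))" using elim by (intro geometric_sums) auto
      have "\<bar>\<Sum>n. e n * x ^ n\<bar> \<le> (\<Sum>n. \<bar>e n\<bar> * x ^ n)"
        using summable_rabs[of "\<lambda>n. e n * x ^ n"] sme[of x] elim by (simp add: abs_mult)
      also have "\<dots> \<le> (\<Sum>n. (if n < N then B else 0) + \<epsilon> / 2 * x ^ n)"
      proof (intro suminf_le sme summable_add summable_mult)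
        fix n
        have "\<bar>e n\<bar> * x ^ n \<le> B * 1"
          using elim B by (intro mult_mono power_le_one) auto
        moreover have "\<bar>e n\<bar> * x ^ n \<le> \<epsilon> / 2 * x ^ n" if "n \<ge> N"
          using elim N[OF that] by (intro mult_right_mono) auto
        ultimately have "\<bar>e n\<bar> * x ^ n \<le> (if n < N then B else \<epsilon> / 2 * x ^ n)"
          by simp
        also have "\<dots> \<le> (if n < N then B else 0) + \<epsilon> / 2 * x ^ n"
          using elim \<epsilon> by auto
        finally show "\<bar>e n\<bar> * x ^ n \<le> (if n < N then B else 0) + \<epsilon> / 2 * x ^ n" .
        show "summable (\<lambda>n. if n < N then B else 0)"
          using sums_If_finite[of "\<lambda>n. n < N" "\<lambda>_. B"] by (auto simp: sums_iff)
      qed (use elim g in \<open>auto simp: sums_iff\<close>)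
      also have "(\<lambda>n. (if n < N then B else 0) + \<epsilon> / 2 * x ^ n) sums (real N * B + \<epsilon> / 2 * (1 / (1 - x)))"
        using sums_If_finite[of "\<lambda>n. n < N" "\<lambda>_. B"] g by (intro sums_add sums_mult) auto
      then have "(\<Sum>n. (if n < N then B else 0) + \<epsilon> / 2 * x ^ n) = real N * B + \<epsilon> / 2 * (1 / (1 - x))"
        by (rule sums_unique [symmetric])
      finally have "(1 - x) * \<bar>\<Sum>n. e n * x ^ n\<bar> \<le> (1 - x) * (real N * B + \<epsilon> / 2 * (1 / (1 - x)))"
        using elim by (intro mult_left_mono) auto
      also have "\<dots> = (1 - x) * (real N * B) + \<epsilon> / 2" using elim by (simp add: field_simps)
      also have "\<dots> < \<epsilon>" using elim by linarith
      finally show ?case using elim by (simp add: abs_mult)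
    qed
  qed
  then have "((\<lambda>x. (\<Sum>n. c n * x ^ n) - s) \<longlongrightarrow> 0) (at_left 1)"
  proof (rule Lim_transform_eventually)
    show "\<forall>\<^sub>F x in at_left 1. (1 - x) * (\<Sum>n. e n * x ^ n) = (\<Sum>n. c n * x ^ n) - s"
      by (rule eventually_mono[OF eventually_at_left_real[of 0 1]]) (auto simp: eq)
  qed
  then show ?thesis by (rule LIM_zero_cancel)
qed

section \<open>Evaluation inside the unit disc\<close>

lemma iter_coef_le_1:
  assumes "set w \<subseteq> {-1..1}"
  shows "\<bar>iter_coef w n\<bar> \<le> 1"
  using assms
proof (induction w arbitrary: n)
  case (Cons e w)
  show ?case
  proof (cases "n = 0")
    case n: False
    have IH: "\<bar>iter_coef w m\<bar> \<le> 1" for m using Cons by simp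
    have "\<bar>iter_coef w n\<bar> \<le> real n" using IH[of n] n by linarith
    moreover have "\<bar>\<Sum>m<n. e ^ (n - Suc m) * iter_coef w m\<bar> \<le> (\<Sum>m<n. 1)"
    proof (rule order_trans[OF sum_abs sum_mono])
      fix m
      have "\<bar>e\<bar> ^ (n - Suc m) * \<bar>iter_coef w m\<bar> \<le> 1 * 1"
        using Cons.prems by (intro mult_mono power_le_one IH) auto
      then show "\<bar>e ^ (n - Suc m) * iter_coef w m\<bar> \<le> 1" by (simp add: abs_mult power_abs)
    qed
    ultimately show ?thesis using n by (auto simp: field_simps)
  qed simp
qed auto

lemma iter_fps_conv_radius:
  assumes "set w \<subseteq> {-1..1}"
  shows "fps_conv_radius (iter_fps w) \<ge> 1"
  unfolding fps_conv_radius_def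
proof (rule conv_radius_geI_ex)
  fix r :: real assume r: "0 < r" "ereal r < 1"
  have "summable (\<lambda>n. iter_coef w n * r ^ n)"
  proof (rule summable_comparison_test')
    show "summable (\<lambda>n. r ^ n)" using r by (intro summable_geometric) auto
    show "norm (iter_coef w n * r ^ n) \<le> r ^ n" for n
      using iter_coef_le_1[OF assms, of n] r by (simp add: abs_mult mult_left_le_one_le)
  qed
  then show "\<exists>z. norm z = r \<and> summable (\<lambda>n. fps_nth (iter_fps w) n * z ^ n)"
    using r by (intro exI[of _ r]) auto
qed

lemma iter_fps_conv_radius_less:
  assumes "set w \<subseteq> {-1..1}" "\<bar>x :: real\<bar> < 1"
  shows "ereal (norm x) < fps_conv_radius (iter_fps w)"
proof -
  have "ereal (norm x) < 1" using assms by simp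
  also have "\<dots> \<le> fps_conv_radius (iter_fps w)" using assms by (intro iter_fps_conv_radius)
  finally show ?thesis .
qed

lemma eval_iter_fps_tendsto:
  assumes "admissible w"
  shows "(eval_fps (iter_fps w) \<longlongrightarrow> iter_val w) (at_left 1)"
  using abel_limit[OF iter_coef_sums[OF assms]] by (simp add: eval_fps_def [abs_def])

text \<open>Radius and value go through one induction, as evaluating a sum requires the radius of
  the remaining list.\<close>

lemma eval_iter_fps_sum_list:
  assumes "\<And>w. w \<in> set ws \<Longrightarrow> set w \<subseteq> {-1..1}" "\<bar>x :: real\<bar> < 1"
  shows "ereal (norm x) < fps_conv_radius (\<Sum>w\<leftarrow>ws. iter_fps w) \<and>
    eval_fps (\<Sum>w\<leftarrow>ws. iter_fps w) x = (\<Sum>w\<leftarrow>ws. eval_fps (iter_fps w) x)"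
  using assms(1)
proof (induction ws)
  case (Cons w ws)
  have 1: "ereal (norm x) < fps_conv_radius (iter_fps w)"
    using Cons.prems assms(2) by (intro iter_fps_conv_radius_less) auto
  have 2: "ereal (norm x) < fps_conv_radius (\<Sum>w\<leftarrow>ws. iter_fps w)"
    "eval_fps (\<Sum>w\<leftarrow>ws. iter_fps w) x = (\<Sum>w\<leftarrow>ws. eval_fps (iter_fps w) x)"
    using Cons by auto
  have "ereal (norm x) < min (fps_conv_radius (iter_fps w)) (fps_conv_radius (\<Sum>w\<leftarrow>ws. iter_fps w))"
    using 1 2 by simp
  also have "\<dots> \<le> fps_conv_radius (iter_fps w + (\<Sum>w\<leftarrow>ws. iter_fps w))"
    by (rule fps_conv_radius_add)
  finally show ?case using eval_fps_add[OF 1 2(1)] 2(2) by simp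
qed (use assms in auto)

lemma tendsto_sum_list:
  fixes g :: "'a \<Rightarrow> 'b::topological_monoid_add"
  assumes "\<And>w. w \<in> set ws \<Longrightarrow> ((\<lambda>x. f w x) \<longlongrightarrow> g w) F"
  shows "((\<lambda>x. \<Sum>w\<leftarrow>ws. f w x) \<longlongrightarrow> (\<Sum>w\<leftarrow>ws. g w)) F"
  using assms by (induction ws) (auto intro!: tendsto_add)

lemma eval_iter_fps_shuffle:
  assumes "set u \<subseteq> {-1..1}" "set v \<subseteq> {-1..1}" "u = [] \<or> last u \<noteq> 0" "v = [] \<or> last v \<noteq> 0" "\<bar>x\<bar> < 1"
  shows "eval_fps (iter_fps u) x * eval_fps (iter_fps v) x = (\<Sum>w\<leftarrow>shuffle_list u v. eval_fps (iter_fps w) x)"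
proof -
  have "eval_fps (iter_fps u) x * eval_fps (iter_fps v) x = eval_fps (iter_fps u * iter_fps v) x"
    using assms by (intro eval_fps_mult [symmetric] iter_fps_conv_radius_less)
  also have "iter_fps u * iter_fps v = (\<Sum>w\<leftarrow>shuffle_list u v. iter_fps w)"
    using assms by (intro iter_fps_shuffle)
  also have "eval_fps \<dots> x = (\<Sum>w\<leftarrow>shuffle_list u v. eval_fps (iter_fps w) x)"
    using assms set_shuffles by (intro conjunct2[OF eval_iter_fps_sum_list]) (fastforce simp: set_shuffle_list)+
  finally show ?thesis .
qed

lemma eventually_at_left_1: "\<forall>\<^sub>F x in at_left (1::real). 0 < x \<and> x < 1"
  by (rule eventually_mono[OF eventually_at_left_real[of 0 1]]) auto

theorem iter_val_shuffle:
  assumes "admissible u" "admissible v"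
  shows "iter_val u * iter_val v = (\<Sum>w\<leftarrow>shuffle_list u v. iter_val w)"
proof (rule tendsto_unique)
  show "((\<lambda>x. eval_fps (iter_fps u) x * eval_fps (iter_fps v) x) \<longlongrightarrow> iter_val u * iter_val v) (at_left 1)"
    using assms by (intro tendsto_mult eval_iter_fps_tendsto)
  have "((\<lambda>x. \<Sum>w\<leftarrow>shuffle_list u v. eval_fps (iter_fps w) x) \<longlongrightarrow> (\<Sum>w\<leftarrow>shuffle_list u v. iter_val w)) (at_left 1)"
    using assms admissible_shuffle by (intro tendsto_sum_list eval_iter_fps_tendsto)
  then show "((\<lambda>x. eval_fps (iter_fps u) x * eval_fps (iter_fps v) x) \<longlongrightarrow> (\<Sum>w\<leftarrow>shuffle_list u v. iter_val w)) (at_left 1)"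
  proof (rule Lim_transform_eventually)
    show "\<forall>\<^sub>F x in at_left 1. (\<Sum>w\<leftarrow>shuffle_list u v. eval_fps (iter_fps w) x) =
        eval_fps (iter_fps u) x * eval_fps (iter_fps v) x"
      using eventually_at_left_1
      by eventually_elim (use assms in \<open>auto simp: admissible_def eval_iter_fps_shuffle\<close>)
  qed
qed (simp add: trivial_limit_at_left_real)

section \<open>Nested sums and the stuffle product\<close>

text \<open>For \<open>z = [(s\<^sub>1, \<sigma>\<^sub>1), (s\<^sub>2, \<sigma>\<^sub>2), \<dots>]\<close> this is the sum of
  \<open>\<sigma>\<^sub>1^n\<^sub>1 / n\<^sub>1^s\<^sub>1 * \<sigma>\<^sub>2^n\<^sub>2 / n\<^sub>2^s\<^sub>2 * \<dots>\<close> over \<open>N \<ge> n\<^sub>1 > n\<^sub>2 > \<dots> \<ge> 1\<close>.\<close>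

fun nested_sum :: "(nat \<times> real) list \<Rightarrow> nat \<Rightarrow> real" where
  "nested_sum [] N = 1"
| "nested_sum ((s, \<sigma>) # z) N = (\<Sum>n<N. \<sigma> ^ Suc n / real (Suc n) ^ s * nested_sum z n)"

fun stuffle :: "(nat \<times> real) list \<Rightarrow> (nat \<times> real) list \<Rightarrow> (nat \<times> real) list list" where
  "stuffle [] v = [v]"
| "stuffle (a # u) [] = [a # u]"
| "stuffle ((s, \<sigma>) # u) ((t, \<tau>) # v) =
     map ((#) (s, \<sigma>)) (stuffle u ((t, \<tau>) # v)) @ map ((#) (t, \<tau>)) (stuffle ((s, \<sigma>) # u) v) @
     map ((#) (s + t, \<sigma> * \<tau>)) (stuffle u v)"

lemma nested_sum_map_Cons:
  "(\<Sum>w\<leftarrow>map ((#) (s, \<sigma>)) ws. nested_sum w N) =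
     (\<Sum>n<N. \<sigma> ^ Suc n / real (Suc n) ^ s * (\<Sum>w\<leftarrow>ws. nested_sum w n))"
  by (induction ws) (simp_all add: sum.distrib distrib_left)

text \<open>Raising N by one changes a product A B by a B + A b + a b, where a and b are the new
  outermost terms; these are the three groups of words in \<open>stuffle\<close>.\<close>

theorem nested_sum_stuffle:
  "nested_sum u N * nested_sum v N = (\<Sum>w\<leftarrow>stuffle u v. nested_sum w N)"
proof (induction u v arbitrary: N rule: stuffle.induct)
  case (3 s \<sigma> u t \<tau> v)
  show ?case
    unfolding stuffle.simps map_append sum_list_append nested_sum_map_Cons 3 [symmetric]
    by (induction N) (simp_all add: algebra_simps power_add power_mult_distrib add_divide_distrib)
qed auto

text \<open>The letters of the word are the partial products of the signs, since an inner sum of the iterated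
  integral carries the power \<open>e^(n\<^sub>1 - n\<^sub>2)\<close>; \<open>p\<close> is the product of the signs already passed. The sign
  records that \<open>dx/(1 - e x)\<close> lacks the factor \<open>e\<close> of \<open>e dx/(1 - e x)\<close>.\<close>

fun nested_word :: "real \<Rightarrow> (nat \<times> real) list \<Rightarrow> real list" where
  "nested_word p [] = []"
| "nested_word p ((s, \<sigma>) # z) = replicate (s - 1) 0 @ (p * \<sigma>) # nested_word (p * \<sigma>) z"

fun nested_sign :: "real \<Rightarrow> (nat \<times> real) list \<Rightarrow> real" where
  "nested_sign p [] = 1"
| "nested_sign p ((s, \<sigma>) # z) = p * \<sigma> * nested_sign (p * \<sigma>) z"

lemma nested_sign_square:
  assumes "p\<^sup>2 = 1" "\<And>s \<sigma>. (s, \<sigma>) \<in> set z \<Longrightarrow> \<sigma>\<^sup>2 = 1"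
  shows "nested_sign p z * nested_sign p z = 1"
  using assms
proof (induction p z rule: nested_sign.induct)
  case (2 p s \<sigma> z)
  have *: "(p * \<sigma>)\<^sup>2 = 1" using 2 by (auto simp: power_mult_distrib)
  moreover have "nested_sign (p * \<sigma>) z * nested_sign (p * \<sigma>) z = 1"
    using 2 * by auto
  moreover have "nested_sign p ((s, \<sigma>) # z) * nested_sign p ((s, \<sigma>) # z) =
      (p * \<sigma>)\<^sup>2 * (nested_sign (p * \<sigma>) z * nested_sign (p * \<sigma>) z)"
    by (simp add: power2_eq_square algebra_simps)
  ultimately show ?case by simp
qed simp

lemma iter_coef_replicate:
  assumes "e \<noteq> 0"
  shows "iter_coef (replicate k 0 @ e # w) n = (\<Sum>m<n. e ^ (n - Suc m) * iter_coef w m) / real n ^ Suc k"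
  using assms by (induction k) auto

text \<open>Only p = 1 is of final interest, but an inner sum inherits the letter \<eta> of its
  outer index through the power \<open>\<eta> ^ (n - m)\<close>, so the induction needs the weights
  \<open>p ^ m\<close>.\<close>

lemma nested_sum_eq_iter_coef:
  assumes "p\<^sup>2 = 1" "\<And>s \<sigma>. (s, \<sigma>) \<in> set z \<Longrightarrow> s > 0 \<and> \<sigma>\<^sup>2 = 1"
  shows "nested_sum z N = nested_sign p z * (\<Sum>m\<le>N. p ^ m * iter_coef (nested_word p z) m)"
  using assms
proof (induction z arbitrary: p N)
  case Nil
  have "(\<Sum>m\<le>N. p ^ m * iter_coef (nested_word p []) m) = (\<Sum>m\<in>{0}. p ^ m * iter_coef (nested_word p []) m)"
    by (rule sum.mono_neutral_right) auto
  then show ?case by simp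
next
  case (Cons x z)
  obtain s \<sigma> where x: "x = (s, \<sigma>)" by force
  define \<eta> where "\<eta> = p * \<sigma>"
  have s: "s > 0" and \<sigma>: "\<sigma>\<^sup>2 = 1" using Cons.prems(2)[of s \<sigma>] by (auto simp: x)
  have \<eta>: "\<eta>\<^sup>2 = 1" using \<sigma> Cons.prems(1) by (simp add: \<eta>_def power_mult_distrib)
  have p\<eta>: "p * \<eta> = \<sigma>" using Cons.prems(1) by (simp add: \<eta>_def power2_eq_square flip: mult.assoc)
  have IH: "nested_sum z N = nested_sign \<eta> z * (\<Sum>m\<le>N. \<eta> ^ m * iter_coef (nested_word \<eta> z) m)" for N
    using Cons.prems \<eta> by (intro Cons.IH) auto
  have sg: "nested_sign \<eta> z * nested_sign \<eta> z = 1"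
    using Cons.prems \<eta> by (intro nested_sign_square) auto
  have \<eta>0: "\<eta> \<noteq> 0" using \<eta> by auto
  \<comment> \<open>As \<eta> squares to 1, only the parity of the exponent counts.\<close>
  have pw: "\<eta> ^ Suc n * \<eta> ^ (n - m) = \<eta> ^ Suc m" if "m \<le> n" for m n
  proof -
    have "\<eta> ^ Suc n * \<eta> ^ (n - m) = \<eta> ^ (Suc m + 2 * (n - m))"
    proof -
      have "Suc n + (n - m) = Suc m + 2 * (n - m)" using that by simp
      then show ?thesis by (simp only: power_add [symmetric])
    qed
    also have "\<dots> = \<eta> ^ Suc m" using \<eta> by (simp only: power_add power_mult) simp
    finally show ?thesis .
  qed
  have "(\<Sum>m\<le>N. p ^ m * iter_coef (nested_word p (x # z)) m) =
      (\<Sum>n<N. p ^ Suc n * iter_coef (nested_word p (x # z)) (Suc n))"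
    using \<eta>0 by (simp add: sum.atMost_shift x iter_coef_replicate flip: \<eta>_def del: power_Suc)
  also have "nested_sign p (x # z) * \<dots> =
     (\<Sum>n<N. \<sigma> ^ Suc n / real (Suc n) ^ s * nested_sum z n)"
    unfolding sum_distrib_left
  proof (rule sum.cong)
    fix n
    have "\<eta> * (\<Sum>m\<le>n. \<eta> ^ (n - m) * iter_coef (nested_word \<eta> z) m) =
        \<eta> ^ Suc n * (\<Sum>m\<le>n. \<eta> ^ m * iter_coef (nested_word \<eta> z) m)"
      unfolding sum_distrib_left
    proof (intro sum.cong refl)
      fix m assume "m \<in> {..n}"
      then have "\<eta> ^ Suc n * \<eta> ^ m = \<eta> ^ Suc (n - m)" using pw[of "n - m" n] by simp
      then show "\<eta> * (\<eta> ^ (n - m) * iter_coef (nested_word \<eta> z) m) =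
         \<eta> ^ Suc n * (\<eta> ^ m * iter_coef (nested_word \<eta> z) m)"
        unfolding mult.assoc [symmetric] by (simp only: power_Suc)
    qed
    also have "(\<Sum>m\<le>n. \<eta> ^ m * iter_coef (nested_word \<eta> z) m) = nested_sign \<eta> z * nested_sum z n"
      unfolding IH using sg by (simp flip: mult.assoc)
    finally have *: "\<eta> * (\<Sum>m\<le>n. \<eta> ^ (n - m) * iter_coef (nested_word \<eta> z) m) =
        \<eta> ^ Suc n * (nested_sign \<eta> z * nested_sum z n)" .
    have "nested_sign p (x # z) * (p ^ Suc n * iter_coef (nested_word p (x # z)) (Suc n)) =
       nested_sign \<eta> z * p ^ Suc n * (\<eta> * (\<Sum>m\<le>n. \<eta> ^ (n - m) * iter_coef (nested_word \<eta> z) m)) / real (Suc n) ^ s"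
      using \<eta>0 s by (simp add: x iter_coef_replicate lessThan_Suc_atMost flip: \<eta>_def del: power_Suc of_nat_Suc)
    also have "\<dots> = (nested_sign \<eta> z * nested_sign \<eta> z) * ((p * \<eta>) ^ Suc n / real (Suc n) ^ s * nested_sum z n)"
      unfolding * power_mult_distrib by (simp del: power_Suc of_nat_Suc)
    finally show "nested_sign p (x # z) * (p ^ Suc n * iter_coef (nested_word p (x # z)) (Suc n)) =
       \<sigma> ^ Suc n / real (Suc n) ^ s * nested_sum z n"
      unfolding sg p\<eta> by simp
  qed simp
  finally show ?case by (simp add: x)
qed

text \<open>Defined by the word and not as a limit, so that unfolding turns a stuffle relation into
  one between values of words.\<close>

definition nested_val :: "(nat \<times> real) list \<Rightarrow> real" where
  "nested_val z = nested_sign 1 z * iter_val (nested_word 1 z)"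

definition convergent_index :: "(nat \<times> real) list \<Rightarrow> bool" where
  "convergent_index z \<longleftrightarrow> z \<noteq> [] \<and> hd z \<noteq> (1, 1) \<and> (\<forall>(s, \<sigma>)\<in>set z. s > 0 \<and> \<sigma> \<in> {1, -1})"

lemma set_nested_word:
  assumes "p \<in> {1, -1}" "\<And>s \<sigma>. (s, \<sigma>) \<in> set z \<Longrightarrow> \<sigma> \<in> {1, -1}"
  shows "set (nested_word p z) \<subseteq> {-1..1}"
  using assms
proof (induction p z rule: nested_word.induct)
  case (2 p s \<sigma> z)
  have "p * \<sigma> \<in> {1, -1}" using 2(2) 2(3)[of s \<sigma>] by auto
  with 2 show ?case by auto
qed auto

lemma last_nested_word:
  assumes "p \<in> {1, -1}" "\<And>s \<sigma>. (s, \<sigma>) \<in> set z \<Longrightarrow> \<sigma> \<in> {1, -1}" "z \<noteq> []"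
  shows "last (nested_word p z) \<noteq> 0"
  using assms
proof (induction p z rule: nested_word.induct)
  case (2 p s \<sigma> z)
  have pe: "p * \<sigma> \<in> {1, -1}" using 2(2) 2(3)[of s \<sigma>] by auto
  have "nested_word (p * \<sigma>) z = [] \<longleftrightarrow> z = []"
    by (cases z) auto
  with pe 2 show ?case by auto
qed auto

lemma admissible_nested_word:
  assumes "convergent_index z"
  shows "admissible (nested_word 1 z)"
proof -
  obtain s \<sigma> z' where z: "z = (s, \<sigma>) # z'"
    using assms by (cases z) (auto simp: convergent_index_def)
  have \<sigma>: "s > 0" "\<sigma> \<in> {1, -1}" "s = 1 \<Longrightarrow> \<sigma> = -1"
    using assms by (auto simp: convergent_index_def z)
  have "hd (nested_word 1 z) \<in> {0, -1}"
    using \<sigma> by (cases "s - 1") (auto simp: z)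
  moreover have "last (nested_word 1 z) \<noteq> 0" "set (nested_word 1 z) \<subseteq> {-1..1}"
    using assms by (intro last_nested_word set_nested_word; fastforce simp: convergent_index_def)+
  ultimately show ?thesis by (auto simp: admissible_def z)
qed

lemma nested_sum_tendsto:
  assumes "convergent_index z"
  shows "nested_sum z \<longlonglongrightarrow> nested_val z"
proof -
  have "nested_sum z = (\<lambda>N. nested_sign 1 z * (\<Sum>m\<le>N. 1 ^ m * iter_coef (nested_word 1 z) m))"
    using assms by (intro ext nested_sum_eq_iter_coef) (auto simp: convergent_index_def)
  moreover have "(\<lambda>N. \<Sum>m\<le>N. iter_coef (nested_word 1 z) m) \<longlonglongrightarrow> iter_val (nested_word 1 z)"
    using iter_coef_sums[OF admissible_nested_word[OF assms]] by (simp add: sums_def_le)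
  ultimately show ?thesis by (auto simp: nested_val_def intro!: tendsto_mult_left)
qed

lemma stuffle_indices:
  assumes "w \<in> set (stuffle u v)"
    "\<forall>(s, \<sigma>)\<in>set u. s > 0 \<and> \<sigma> \<in> {1, -1}" "\<forall>(s, \<sigma>)\<in>set v. s > 0 \<and> \<sigma> \<in> {1, -1}"
  shows "\<forall>(s, \<sigma>)\<in>set w. s > 0 \<and> \<sigma> \<in> {1, -1}"
  using assms by (induction u v arbitrary: w rule: stuffle.induct) fastforce+

text \<open>The first entry comes from u or v, or is a merged one with exponent at least 2, so it is
  never (1, 1).\<close>

lemma convergent_index_stuffle:
  assumes "convergent_index u" "convergent_index v" "w \<in> set (stuffle u v)"
  shows "convergent_index w"
proof -
  obtain s \<sigma> u' t \<tau> v' where uv: "u = (s, \<sigma>) # u'" "v = (t, \<tau>) # v'"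
    using assms(1,2) by (cases u; cases v) (auto simp: convergent_index_def)
  show ?thesis
    using assms stuffle_indices[OF assms(3)] unfolding convergent_index_def uv by auto
qed

theorem nested_val_stuffle:
  assumes "convergent_index u" "convergent_index v"
  shows "nested_val u * nested_val v = (\<Sum>w\<leftarrow>stuffle u v. nested_val w)"
proof (rule LIMSEQ_unique)
  show "(\<lambda>N. nested_sum u N * nested_sum v N) \<longlonglongrightarrow> nested_val u * nested_val v"
    using assms by (intro tendsto_mult nested_sum_tendsto)
  show "(\<lambda>N. nested_sum u N * nested_sum v N) \<longlonglongrightarrow> (\<Sum>w\<leftarrow>stuffle u v. nested_val w)"
    unfolding nested_sum_stuffle
    using assms convergent_index_stuffle by (intro tendsto_sum_list nested_sum_tendsto)
qed

section \<open>The regularized double shuffle relation\<close>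

text \<open>Interpolates between the bound 1 and Bernoulli's bound n (1 - x). It trades a factor
  \<open>n powr a\<close>, which the coefficients of words starting with 0 can spare for small a,
  for a rate of convergence at 1.\<close>

lemma one_minus_power_le:
  assumes "0 < x" "x < 1" "0 < a" "a \<le> (1::real)"
  shows "1 - x ^ n \<le> real n powr a * (1 - x) powr a"
proof (cases "n = 0")
  case False
  have "1 - x ^ n \<le> real n * (1 - x)"
    using Bernoulli_inequality[of "x - 1" n] assms by (simp add: algebra_simps)
  moreover have "1 - x ^ n \<le> 1" using assms by simp
  moreover have "min 1 y \<le> y powr a" if "y > 0" for y :: real
  proof (cases "y \<le> 1")
    case True
    then show ?thesis using powr_mono'[of a 1 y] assms that by simp
  next
    case False
    then show ?thesis using ge_one_powr_ge_zero[of y a] assms by simp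
  qed
  ultimately have "1 - x ^ n \<le> (real n * (1 - x)) powr a"
    using False assms by (intro order_trans[OF _ \<open>\<And>y. y > 0 \<Longrightarrow> min 1 y \<le> y powr a\<close>]) auto
  then show ?thesis using assms by (simp add: powr_mult)
qed simp

lemma iter_coef_1: "iter_coef [1] n = 1 / real n"
proof (cases "n = 0")
  case False
  then have "(\<Sum>m<n. if m = 0 then 1 else 0) = (1::real)"
    by (subst sum.delta) auto
  then show ?thesis by simp
qed simp

lemma eval_iter_fps_1:
  assumes "0 < x" "x < 1"
  shows "eval_fps (iter_fps [1]) x = - ln (1 - x)"
proof -
  have "(\<lambda>n. - ((- (- x)) ^ n) / real n) sums ln (1 + (- x))"
    using assms by (intro ln_series') auto
  then have "(\<lambda>n. iter_coef [1] n * x ^ n) sums - ln (1 - x)"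
    using sums_minus by (fastforce simp: iter_coef_1 simp del: iter_coef.simps)
  then show ?thesis by (simp add: eval_fps_def sums_iff)
qed

lemma ln_mult_powr_tendsto_0:
  assumes "a > 0"
  shows "((\<lambda>x. ln (1 - x) * (1 - x) powr a) \<longlongrightarrow> 0) (at_left (1::real))"
proof (rule Lim_null_comparison)
  show "\<forall>\<^sub>F x in at_left 1. norm (ln (1 - x) * (1 - x) powr a) \<le> (1 - x) powr (a / 2) * (2 / a)"
    using eventually_at_left_1
  proof eventually_elim
    case (elim x)
    have "ln (1 / (1 - x)) \<le> (1 / (1 - x)) powr (a / 2) / (a / 2)"
      using elim assms by (intro ln_powr_bound) auto
    then have "\<bar>ln (1 - x)\<bar> \<le> (1 - x) powr (- (a / 2)) * (2 / a)"
      using elim by (simp add: ln_div powr_divide powr_minus field_simps)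
    then have "\<bar>ln (1 - x)\<bar> * (1 - x) powr a \<le> (1 - x) powr (- (a / 2)) * (2 / a) * (1 - x) powr a"
      by (intro mult_right_mono) auto
    also have "\<dots> = (1 - x) powr (a / 2) * (2 / a)"
      by (simp flip: powr_add)
    finally show ?case by (simp add: abs_mult)
  qed
  have "((\<lambda>x. (1 - x) powr (a / 2) * (2 / a)) \<longlongrightarrow> (1 - 1) powr (a / 2) * (2 / a)) (at_left (1::real))"
    using assms by (intro tendsto_intros) (auto simp: eventually_at_filter)
  then show "((\<lambda>x. (1 - x) powr (a / 2) * (2 / a)) \<longlongrightarrow> 0) (at_left (1::real))" by simp
qed

text \<open>The coefficients stay summable after multiplication with \<open>n powr (1/4)\<close>, so
  the distance to the value at 1 is of order \<open>(1 - x) powr (1/4)\<close>, which beats the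
  logarithm.\<close>

lemma eval_iter_fps_1_mult_tendsto_0:
  assumes w: "admissible (0 # w)"
  shows "((\<lambda>x. eval_fps (iter_fps [1]) x * (iter_val (0 # w) - eval_fps (iter_fps (0 # w)) x)) \<longlongrightarrow> 0) (at_left 1)"
proof -
  let ?c = "iter_coef (0 # w)"
  have set: "set w \<subseteq> {-1..1}" using w by (simp add: admissible_def)
  obtain K where K: "K > 0" "\<And>n. \<bar>?c n\<bar> \<le> K * real n powr (1 / 4 - 2)"
    using iter_coef_0_powr_bound[OF set, of "1/4"] by auto
  have bd: "\<bar>?c n * real n powr (1/4)\<bar> \<le> K * real n powr (-3/2)" for n
  proof -
    have "\<bar>?c n * real n powr (1/4)\<bar> \<le> K * real n powr (1 / 4 - 2) * real n powr (1/4)"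
      unfolding abs_mult using mult_right_mono[OF K(2)[of n], of "real n powr (1/4)"] by simp
    then show ?thesis by (simp flip: powr_add add: mult.assoc)
  qed
  define C where "C = (\<Sum>n. \<bar>?c n * real n powr (1/4)\<bar>)"
  have sC: "summable (\<lambda>n. \<bar>?c n * real n powr (1/4)\<bar>)"
    using bd by (intro summable_powr_bounded[of _ K "-3/2"]) auto
  have le: "\<bar>iter_val (0 # w) - eval_fps (iter_fps (0 # w)) x\<bar> \<le> C * (1 - x) powr (1/4)"
    if x: "0 < x" "x < 1" for x
  proof -
    have "(\<lambda>n. ?c n * x ^ n) sums eval_fps (iter_fps (0 # w)) x"
      using sums_eval_fps[OF iter_fps_conv_radius_less[of "0 # w" x]] set x by simp
    from sums_diff[OF iter_coef_sums[OF w] this]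
    have s: "(\<lambda>n. ?c n * (1 - x ^ n)) sums (iter_val (0 # w) - eval_fps (iter_fps (0 # w)) x)"
      by (simp add: right_diff_distrib)
    have b: "\<bar>?c n * (1 - x ^ n)\<bar> \<le> \<bar>?c n * real n powr (1/4)\<bar> * (1 - x) powr (1/4)" for n
    proof -
      have "0 \<le> 1 - x ^ n" using x by (simp add: power_le_one)
      then have "\<bar>?c n * (1 - x ^ n)\<bar> = \<bar>?c n\<bar> * (1 - x ^ n)" by (simp add: abs_mult)
      also have "\<dots> \<le> \<bar>?c n\<bar> * (real n powr (1/4) * (1 - x) powr (1/4))"
        using x by (intro mult_left_mono one_minus_power_le) auto
      finally show ?thesis by (simp add: abs_mult)
    qed
    have sm: "summable (\<lambda>n. \<bar>?c n * (1 - x ^ n)\<bar>)"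
      by (rule summable_comparison_test'[OF summable_mult2[OF sC, of "(1 - x) powr (1/4)"]]) (use b in simp)
    have "\<bar>\<Sum>n. ?c n * (1 - x ^ n)\<bar> \<le> (\<Sum>n. \<bar>?c n * (1 - x ^ n)\<bar>)"
      by (rule summable_rabs[OF sm])
    also have "\<dots> \<le> (\<Sum>n. \<bar>?c n * real n powr (1/4)\<bar> * (1 - x) powr (1/4))"
      by (rule suminf_le[OF b sm summable_mult2[OF sC]])
    also have "\<dots> = C * (1 - x) powr (1/4)"
      unfolding C_def by (rule suminf_mult2 [symmetric, OF sC])
    finally show ?thesis using s by (simp add: sums_iff)
  qed
  show ?thesis
  proof (rule Lim_null_comparison)
    show "\<forall>\<^sub>F x in at_left 1. norm (eval_fps (iter_fps [1]) x * (iter_val (0 # w) - eval_fps (iter_fps (0 # w)) x))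
        \<le> C * \<bar>ln (1 - x) * (1 - x) powr (1/4)\<bar>"
      using eventually_at_left_1
    proof eventually_elim
      case (elim x)
      have "\<bar>ln (1 - x)\<bar> * \<bar>iter_val (0 # w) - eval_fps (iter_fps (0 # w)) x\<bar>
          \<le> \<bar>ln (1 - x)\<bar> * (C * (1 - x) powr (1/4))"
        using elim by (intro mult_left_mono le) auto
      then show ?case using elim by (simp add: eval_iter_fps_1 abs_mult mult_ac)
    qed
    show "((\<lambda>x. C * \<bar>ln (1 - x) * (1 - x) powr (1/4)\<bar>) \<longlongrightarrow> 0) (at_left 1)"
      using ln_mult_powr_tendsto_0[of "1/4"] by (intro tendsto_mult_right_zero tendsto_rabs_zero) auto
  qed
qed

text \<open>As \<open>harm\<close> increases, \<open>harm N\<close> can be moved into the tail as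
  \<open>harm n\<close>; that series still converges absolutely, with exponent 1/4 + 1/4 - 2 =
  -3/2.\<close>

lemma harm_mult_tail_tendsto_0:
  assumes w: "admissible (0 # w)"
  shows "(\<lambda>N. harm N * (iter_val (0 # w) - (\<Sum>n\<le>N. iter_coef (0 # w) n))) \<longlonglongrightarrow> 0"
proof -
  let ?c = "iter_coef (0 # w)"
  have set: "set w \<subseteq> {-1..1}" using w by (simp add: admissible_def)
  obtain K where K: "K > 0" "\<And>n. \<bar>?c n\<bar> \<le> K * real n powr (1 / 4 - 2)"
    using iter_coef_0_powr_bound[OF set, of "1/4"] by auto
  obtain M where M: "M > 0" "\<And>n. n > 0 \<Longrightarrow> (1 + harm n) ^ 1 \<le> M * real n powr (1/4)"
    using harm_power_bound[of "1/4" 1] by auto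
  have bd: "\<bar>harm n * ?c n\<bar> \<le> (M * K) * real n powr (-3/2)" for n
  proof (cases "n = 0")
    case False
    have "harm n * \<bar>?c n\<bar> \<le> (M * real n powr (1/4)) * (K * real n powr (1 / 4 - 2))"
      using M(2)[of n] K False M(1) by (intro mult_mono) (auto simp: harm_nonneg)
    also have "\<dots> = (M * K) * (real n powr (1/4) * real n powr (1 / 4 - 2))" by simp
    also have "\<dots> = (M * K) * real n powr (-3/2)" by (simp flip: powr_add)
    finally show ?thesis by (simp add: abs_mult)
  qed simp
  have sm: "summable (\<lambda>n. \<bar>harm n * ?c n\<bar>)"
    using bd by (intro summable_powr_bounded[of _ "M * K" "-3/2"]) auto
  define tail where "tail N = (\<Sum>n. \<bar>harm n * ?c n\<bar>) - (\<Sum>n\<le>N. \<bar>harm n * ?c n\<bar>)" for N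
  have "tail \<longlonglongrightarrow> (\<Sum>n. \<bar>harm n * ?c n\<bar>) - (\<Sum>n. \<bar>harm n * ?c n\<bar>)"
    using summable_LIMSEQ'[OF sm] unfolding tail_def by (intro tendsto_diff tendsto_const)
  then have tail: "tail \<longlonglongrightarrow> 0" by simp
  show ?thesis
  proof (rule Lim_null_comparison[OF always_eventually tail], rule allI)
    fix N
    have s1: "(\<lambda>n. ?c (n + Suc N)) sums (iter_val (0 # w) - (\<Sum>n\<le>N. ?c n))"
      using sums_split_initial_segment[OF iter_coef_sums[OF w], of "Suc N"] by (simp add: lessThan_Suc_atMost)
    have s2: "(\<lambda>n. \<bar>harm (n + Suc N) * ?c (n + Suc N)\<bar>) sums tail N"
      using sums_split_initial_segment[OF summable_sums[OF sm], of "Suc N"]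
      by (simp add: tail_def lessThan_Suc_atMost)
    have s3: "(\<lambda>n. harm N * ?c (n + Suc N)) sums (harm N * (iter_val (0 # w) - (\<Sum>n\<le>N. ?c n)))"
      by (rule sums_mult[OF s1])
    have le: "\<bar>harm N * ?c (n + Suc N)\<bar> \<le> \<bar>harm (n + Suc N) * ?c (n + Suc N)\<bar>" for n
      unfolding abs_mult by (intro mult_right_mono) (auto simp: harm_mono)
    have sm': "summable (\<lambda>n. \<bar>harm N * ?c (n + Suc N)\<bar>)"
      by (rule summable_comparison_test'[OF sums_summable[OF s2]]) (use le in simp)
    have "\<bar>\<Sum>n. harm N * ?c (n + Suc N)\<bar> \<le> (\<Sum>n. \<bar>harm N * ?c (n + Suc N)\<bar>)"
      by (rule summable_rabs[OF sm'])
    also have "\<dots> \<le> (\<Sum>n. \<bar>harm (n + Suc N) * ?c (n + Suc N)\<bar>)"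
      by (rule suminf_le[OF le sm' sums_summable[OF s2]])
    finally show "norm (harm N * (iter_val (0 # w) - (\<Sum>n\<le>N. ?c n))) \<le> tail N"
      using s2 s3 by (simp add: sums_iff)
  qed
qed

lemma admissible_0_Cons_shuffle:
  assumes "admissible (0 # w)" "y \<in> set (shuffle_list [1] w)"
  shows "admissible (0 # y)"
proof -
  have "set y \<subseteq> {-1..1}"
    using assms set_shuffles[of y "[1]" w] by (auto simp: set_shuffle_list admissible_def)
  moreover have "last y \<noteq> 0 \<and> y \<noteq> []"
    using assms(2) assms(1)
  proof (induction w arbitrary: y)
    case (Cons e w)
    then consider "y = 1 # e # w" | z where "y = e # z" "z \<in> set (shuffle_list [1] w)" by auto
    then show ?case
      using Cons.IH Cons.prems by cases (auto simp: admissible_def split: if_splits)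
  qed (auto simp: admissible_def)
  ultimately show ?thesis by (auto simp: admissible_def)
qed

text \<open>Compare the shuffle and the stuffle product of the divergent word \<open>[1]\<close> with a word \<open>0 # w\<close>. Both
  contain the divergent word \<open>1 # 0 # w\<close> exactly once. With \<open>V\<close> the value of \<open>0 # w\<close>, the function \<open>V\<close>
  times that of \<open>[1]\<close> minus that of \<open>1 # 0 # w\<close> has a limit at 1, which both products compute.\<close>

theorem regularized_double_shuffle:
  assumes z: "convergent_index ((Suc (Suc s), \<sigma>) # z)"
  defines "w \<equiv> replicate s 0 @ \<sigma> # nested_word \<sigma> z"
  shows "nested_sign 1 ((Suc (Suc s), \<sigma>) # z) * (\<Sum>y\<leftarrow>shuffle_list [1] w. iter_val (0 # y)) =
    (\<Sum>y\<leftarrow>stuffle [(1, 1)] z. nested_val ((Suc (Suc s), \<sigma>) # y)) + nested_val ((Suc (Suc (Suc s)), \<sigma>) # z)"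
proof -
  define Z where "Z = (Suc (Suc s), \<sigma>) # z"
  define sg where "sg = nested_sign 1 Z"
  have w: "nested_word 1 Z = 0 # w" by (simp add: Z_def w_def)
  have adm: "admissible (0 # w)"
    using admissible_nested_word[OF z] unfolding w[symmetric] Z_def .
  have sq: "\<And>s \<sigma>'. (s, \<sigma>') \<in> set Z \<Longrightarrow> s > 0 \<and> \<sigma>'\<^sup>2 = 1"
    using z by (auto simp: convergent_index_def Z_def)
  have sg2: "sg * sg = 1"
    unfolding sg_def using sq by (intro nested_sign_square) auto
  \<comment> \<open>The stuffle terms other than the divergent one; their first exponents are at
    least 2, so all converge.\<close>
  define rest where "rest = map ((#) (Suc (Suc s), \<sigma>)) (stuffle [(1, 1)] z) @ [(Suc (Suc (Suc s)), \<sigma>) # z]"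
  define Q where "Q = (\<Sum>y\<leftarrow>rest. nested_val y)"
  define V where "V = iter_val (0 # w)"
  have harm: "nested_sum [(1, 1)] N = harm N" for N
    by (simp add: harm_altdef divide_inverse)
  have Zc: "nested_sum Z N = sg * (\<Sum>n\<le>N. iter_coef (0 # w) n)" for N
    using nested_sum_eq_iter_coef[of 1 Z N] sq by (simp add: sg_def w)
  have Zc1: "nested_sum ((1, 1) # Z) N = sg * (\<Sum>n\<le>N. iter_coef (1 # 0 # w) n)" for N
  proof -
    have "nested_sum ((1, 1) # Z) N = nested_sign 1 ((1, 1) # Z) * (\<Sum>n\<le>N. 1 ^ n * iter_coef (nested_word 1 ((1, 1) # Z)) n)"
      using sq by (intro nested_sum_eq_iter_coef) auto
    then show ?thesis by (simp add: sg_def w del: iter_coef.simps)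
  qed
  have st: "harm N * nested_sum Z N = nested_sum ((1, 1) # Z) N + (\<Sum>y\<leftarrow>rest. nested_sum y N)" for N
  proof -
    have "harm N * nested_sum Z N = (\<Sum>y\<leftarrow>stuffle [(1, 1)] Z. nested_sum y N)"
      unfolding harm [symmetric] by (rule nested_sum_stuffle)
    also have "\<dots> = nested_sum ((1, 1) # Z) N + (\<Sum>y\<leftarrow>rest. nested_sum y N)"
      by (simp add: Z_def rest_def del: nested_sum.simps)
    finally show ?thesis .
  qed
  have harm1: "(\<Sum>n\<le>N. iter_coef [1] n) = harm N" for N
    unfolding iter_coef_1 sum.atMost_shift by (simp add: harm_altdef divide_inverse)
  have "convergent_index y" if "y \<in> set rest" for y
  proof -
    have zz: "\<forall>(s, \<sigma>)\<in>set z. s > 0 \<and> \<sigma> \<in> {1, -1}" "\<sigma> \<in> {1, -1}"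
      using z by (auto simp: convergent_index_def)
    from that consider y' where "y = (Suc (Suc s), \<sigma>) # y'" "y' \<in> set (stuffle [(1, 1)] z)"
      | "y = (Suc (Suc (Suc s)), \<sigma>) # z"
      by (auto simp: rest_def)
    then show ?thesis
    proof cases
      case 1
      show ?thesis using stuffle_indices[OF 1(2) _ zz(1)] zz 1(1) by (simp add: convergent_index_def)
    next
      case 2
      then show ?thesis using zz by (simp add: convergent_index_def)
    qed
  qed
  then have rest_lim: "(\<lambda>N. \<Sum>y\<leftarrow>rest. nested_sum y N) \<longlonglongrightarrow> Q"
    unfolding Q_def by (intro tendsto_sum_list nested_sum_tendsto)
  \<comment> \<open>Replacing V by the N-th partial sum of \<open>0 # w\<close> costs
    \<open>harm N\<close> times a tail, which vanishes; the stuffle product then cancels the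
    divergent word and leaves \<open>rest\<close>.\<close>
  have "(\<lambda>n. V * iter_coef [1] n - iter_coef (1 # 0 # w) n) sums (sg * Q)"
    unfolding sums_def_le
  proof (rule Lim_transform_eventually[OF _ always_eventually])
    show "(\<lambda>N. harm N * (V - (\<Sum>n\<le>N. iter_coef (0 # w) n)) + sg * (\<Sum>y\<leftarrow>rest. nested_sum y N)) \<longlonglongrightarrow> sg * Q"
      using tendsto_add[OF harm_mult_tail_tendsto_0[OF adm] tendsto_mult_left[OF rest_lim, of sg]]
      by (simp add: V_def)
    show "\<forall>N. harm N * (V - (\<Sum>n\<le>N. iter_coef (0 # w) n)) + sg * (\<Sum>y\<leftarrow>rest. nested_sum y N) =
        (\<Sum>n\<le>N. V * iter_coef [1] n - iter_coef (1 # 0 # w) n)"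
    proof
      fix N
      have "sg * (\<Sum>y\<leftarrow>rest. nested_sum y N) = sg * (harm N * nested_sum Z N - nested_sum ((1, 1) # Z) N)"
        by (simp add: st del: nested_sum.simps)
      also have "\<dots> = (sg * sg) * (harm N * (\<Sum>n\<le>N. iter_coef (0 # w) n) - (\<Sum>n\<le>N. iter_coef (1 # 0 # w) n))"
        unfolding Zc Zc1 by (simp add: algebra_simps del: iter_coef.simps)
      finally have "sg * (\<Sum>y\<leftarrow>rest. nested_sum y N) =
          harm N * (\<Sum>n\<le>N. iter_coef (0 # w) n) - (\<Sum>n\<le>N. iter_coef (1 # 0 # w) n)"
        by (simp add: sg2 del: iter_coef.simps)
      then show "harm N * (V - (\<Sum>n\<le>N. iter_coef (0 # w) n)) + sg * (\<Sum>y\<leftarrow>rest. nested_sum y N) =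
        (\<Sum>n\<le>N. V * iter_coef [1] n - iter_coef (1 # 0 # w) n)"
        by (simp add: sum_subtractf algebra_simps harm1 flip: sum_distrib_left del: iter_coef.simps)
    qed
  qed
  then have lim1: "((\<lambda>x. \<Sum>n. (V * iter_coef [1] n - iter_coef (1 # 0 # w) n) * x ^ n) \<longlongrightarrow> sg * Q) (at_left 1)"
    by (rule abel_limit)
  have set: "set w \<subseteq> {-1..1}" "last (0 # w) \<noteq> 0" using adm by (auto simp: admissible_def)
  \<comment> \<open>Below 1 the shuffle product cancels the same divergent word and leaves words
    starting with 0, plus a logarithm times the deviation from V.\<close>
  have eq: "(\<Sum>n. (V * iter_coef [1] n - iter_coef (1 # 0 # w) n) * x ^ n) =
     eval_fps (iter_fps [1]) x * (V - eval_fps (iter_fps (0 # w)) x) + (\<Sum>y\<leftarrow>shuffle_list [1] w. eval_fps (iter_fps (0 # y)) x)"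
    if x: "0 < x" "x < 1" for x
  proof -
    have "(\<lambda>n. iter_coef [1] n * x ^ n) sums eval_fps (iter_fps [1]) x"
      using sums_eval_fps[OF iter_fps_conv_radius_less[of "[1]" x]] x by simp
    moreover have "(\<lambda>n. iter_coef (1 # 0 # w) n * x ^ n) sums eval_fps (iter_fps (1 # 0 # w)) x"
      using sums_eval_fps[OF iter_fps_conv_radius_less[of "1 # 0 # w" x]] x set by simp
    ultimately have "(\<lambda>n. V * (iter_coef [1] n * x ^ n) - iter_coef (1 # 0 # w) n * x ^ n) sums
        (V * eval_fps (iter_fps [1]) x - eval_fps (iter_fps (1 # 0 # w)) x)"
      by (intro sums_diff sums_mult)
    moreover have "eval_fps (iter_fps [1]) x * eval_fps (iter_fps (0 # w)) x =
        (\<Sum>y\<leftarrow>shuffle_list [1] (0 # w). eval_fps (iter_fps y) x)"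
      using x set by (intro eval_iter_fps_shuffle) auto
    ultimately show ?thesis
      by (simp add: sums_iff algebra_simps o_def del: iter_coef.simps)
  qed
  have "((\<lambda>x. eval_fps (iter_fps [1]) x * (V - eval_fps (iter_fps (0 # w)) x) + (\<Sum>y\<leftarrow>shuffle_list [1] w. eval_fps (iter_fps (0 # y)) x))
     \<longlongrightarrow> 0 + (\<Sum>y\<leftarrow>shuffle_list [1] w. iter_val (0 # y))) (at_left 1)"
    unfolding V_def
    by (intro tendsto_add eval_iter_fps_1_mult_tendsto_0 tendsto_sum_list eval_iter_fps_tendsto adm)
       (rule admissible_0_Cons_shuffle[OF adm])
  then have "((\<lambda>x. \<Sum>n. (V * iter_coef [1] n - iter_coef (1 # 0 # w) n) * x ^ n)
     \<longlongrightarrow> 0 + (\<Sum>y\<leftarrow>shuffle_list [1] w. iter_val (0 # y))) (at_left 1)"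
    by (rule Lim_transform_eventually) (rule eventually_mono[OF eventually_at_left_1], use eq in auto)
  from tendsto_unique[OF _ lim1 this]
  have "sg * Q = (\<Sum>y\<leftarrow>shuffle_list [1] w. iter_val (0 # y))"
    by (simp add: trivial_limit_at_left_real)
  then have "sg * (\<Sum>y\<leftarrow>shuffle_list [1] w. iter_val (0 # y)) = (sg * sg) * Q"
    by simp
  also have "\<dots> = Q" by (simp add: sg2)
  also have "Q = (\<Sum>y\<leftarrow>stuffle [(1, 1)] z. nested_val ((Suc (Suc s), \<sigma>) # y)) + nested_val ((Suc (Suc (Suc s)), \<sigma>) # z)"
    by (simp add: Q_def rest_def o_def)
  finally show ?thesis by (simp only: sg_def Z_def)
qed

section \<open>Words of depth one and the polylogarithm at 1/2\<close>

lemma iter_coef_depth_1: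
  assumes "e \<noteq> 0"
  shows "iter_coef (replicate k 0 @ [e]) n = e ^ (n - 1) / real n ^ Suc k"
proof (cases "n = 0")
  case False
  have "(\<Sum>m<n. e ^ (n - Suc m) * iter_coef [] m) = (\<Sum>m\<in>{0}. e ^ (n - Suc m) * iter_coef [] m)"
    using False by (intro sum.mono_neutral_right) auto
  then show ?thesis using assms by (simp add: iter_coef_replicate)
qed (use assms in \<open>simp add: iter_coef_replicate\<close>)

lemma admissible_depth_1: "k > 0 \<Longrightarrow> e \<in> {-1, 1} \<Longrightarrow> admissible (replicate k 0 @ [e])"
  by (cases k) (auto simp: admissible_def)

lemma iter_val_neg1: "iter_val [-1] = ln 2"
proof -
  have "(\<lambda>n. iter_coef [-1] (Suc n)) sums ln 2"
    using alternating_harmonic_series_sums iter_coef_depth_1[of "-1" 0] by (simp del: iter_coef.simps)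
  then have "iter_coef [-1] sums ln 2" by (subst (asm) sums_Suc_iff) simp
  then show ?thesis by (simp add: iter_val_def sums_iff del: iter_coef.simps)
qed

lemma iter_val_eq_zeta:
  assumes "k > 0"
  shows "iter_val (replicate k 0 @ [1]) = zeta (real (Suc k))"
proof -
  have "iter_coef (replicate k 0 @ [1]) sums iter_val (replicate k 0 @ [1])"
    using assms by (intro iter_coef_sums admissible_depth_1) auto
  then have "(\<lambda>n. iter_coef (replicate k 0 @ [1]) (Suc n)) sums iter_val (replicate k 0 @ [1])"
    by (subst sums_Suc_iff) (simp add: iter_coef_depth_1)
  moreover have "(\<lambda>n. iter_coef (replicate k 0 @ [1]) (Suc n)) = (\<lambda>n. 1 / real (Suc n) powr real (Suc k))"
    by (rule ext, subst powr_realpow) (simp_all add: iter_coef_depth_1)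
  ultimately show ?thesis by (simp add: zeta_def sums_iff)
qed

text \<open>The distribution relation in depth one: the two coefficients agree at odd n and are
  opposite at even n, so the difference of the values is twice the even part, a fraction 2 / 2^(k+1)
  of the whole.\<close>

lemma iter_val_depth_1_neg1:
  assumes "k > 0"
  shows "iter_val (replicate k 0 @ [-1]) = (1 - 1 / 2 ^ k) * iter_val (replicate k 0 @ [1])"
proof -
  let ?p = "replicate k 0 @ [1]" and ?m = "replicate k 0 @ [-1]"
  have p: "iter_coef ?p sums iter_val ?p" and m: "iter_coef ?m sums iter_val ?m"
    using assms by (intro iter_coef_sums admissible_depth_1; simp)+
  have "(\<lambda>n. (1 / 2 ^ k) * iter_coef ?p n) sums ((1 / 2 ^ k) * iter_val ?p)"
    by (rule sums_mult[OF p])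
  also have "(\<lambda>n. (1 / 2 ^ k) * iter_coef ?p n) = (\<lambda>n. iter_coef ?p (2 * n) - iter_coef ?m (2 * n))"
  proof (rule ext)
    fix n
    have "(-1) ^ (2 * n - 1) = (-1 :: real)" if "n > 0"
      using that by (cases n) auto
    then show "(1 / 2 ^ k) * iter_coef ?p n = iter_coef ?p (2 * n) - iter_coef ?m (2 * n)"
      by (cases "n = 0") (simp_all add: iter_coef_depth_1 field_simps power_mult_distrib)
  qed
  finally have even: "(\<lambda>n. iter_coef ?p (2 * n) - iter_coef ?m (2 * n)) sums ((1 / 2 ^ k) * iter_val ?p)" .
  have "iter_coef ?p n - iter_coef ?m n = 0" if "n \<notin> range (\<lambda>n. 2 * n)" for n
  proof -
    have "odd n" using that by (auto elim!: evenE)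
    then show ?thesis by (elim oddE) (simp add: iter_coef_depth_1)
  qed
  with even have "(\<lambda>n. iter_coef ?p n - iter_coef ?m n) sums ((1 / 2 ^ k) * iter_val ?p)"
    by (subst (asm) sums_mono_reindex) (auto simp: strict_mono_def)
  with sums_diff[OF p m] have "iter_val ?p - iter_val ?m = (1 / 2 ^ k) * iter_val ?p"
    by (rule sums_unique2)
  then show ?thesis by (simp add: algebra_simps)
qed

section \<open>The polylogarithm under a change of variables\<close>

lemma polylog_eq_eval_iter_fps:
  assumes "\<bar>x\<bar> < 1"
  shows "polylog (Suc k) x = eval_fps (iter_fps (replicate k 0 @ [1])) x"
proof -
  let ?c = "iter_coef (replicate k 0 @ [1])"
  have "(\<lambda>n. ?c n * x ^ n) sums eval_fps (iter_fps (replicate k 0 @ [1])) x"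
    using sums_eval_fps[OF iter_fps_conv_radius_less[of "replicate k 0 @ [1]" x]] assms by (simp add: set_replicate_conv_if)
  then have "(\<lambda>n. ?c (Suc n) * x ^ Suc n) sums eval_fps (iter_fps (replicate k 0 @ [1])) x"
    by (subst sums_Suc_iff) (simp add: iter_coef_depth_1)
  then show ?thesis by (simp add: polylog_def sums_iff iter_coef_depth_1)
qed

lemma eval_iter_fps_deriv:
  assumes "set (e # w) \<subseteq> {-1..1}" "e = 0 \<Longrightarrow> w \<noteq> []" "0 < x" "x < 1"
  shows "(eval_fps (iter_fps (e # w)) has_real_derivative
    eval_fps (iter_fps w) x / (if e = 0 then x else 1 - e * x)) (at x)"
proof -
  have r: "ereal (norm x) < fps_conv_radius (iter_fps (e # w))"
    using assms by (intro iter_fps_conv_radius_less) auto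
  have r': "ereal (norm x) < fps_conv_radius (fps_deriv (iter_fps (e # w)))"
    using r fps_conv_radius_deriv[of "iter_fps (e # w)"] by simp
  have ker: "fps_conv_radius (iter_ker e) = \<infinity> \<and> eval_fps (iter_ker e) x = (if e = 0 then x else 1 - e * x)"
  proof (cases "e = 0")
    case False
    have 1: "fps_conv_radius (fps_const e * fps_X) = \<infinity>"
      using False by (simp add: fps_conv_radius_cmult_left)
    have "fps_conv_radius (1 - fps_const e * fps_X) \<ge> \<infinity>"
      using fps_conv_radius_diff[of 1 "fps_const e * fps_X"] 1 by simp
    moreover have "eval_fps (1 - fps_const e * fps_X) x = 1 - e * x"
      using 1 by (simp add: eval_fps_diff eval_fps_mult)
    ultimately show ?thesis using False by (simp add: iter_ker_def)
  qed (simp add: iter_ker_def)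
  have "eval_fps (iter_ker e) x * eval_fps (fps_deriv (iter_fps (e # w))) x = eval_fps (iter_fps w) x"
    using eval_fps_mult[of x "iter_ker e" "fps_deriv (iter_fps (e # w))"] iter_fps_deriv[OF assms(2)] r' ker
    by simp
  moreover have "(if e = 0 then x else 1 - e * x) > 0"
  proof -
    have "e * x \<le> 1 * x" using assms by (intro mult_right_mono) auto
    then have "e * x < 1" using assms by linarith
    then show ?thesis using assms by auto
  qed
  ultimately have "eval_fps (fps_deriv (iter_fps (e # w))) x =
      eval_fps (iter_fps w) x / (if e = 0 then x else 1 - e * x)"
    using ker by (auto simp: field_simps)
  then show ?thesis using has_field_derivative_eval_fps[OF r, of UNIV] by simp
qed

text \<open>Under \<open>x \<mapsto> x / (1 + x)\<close> the form \<open>dx/x\<close> becomes \<open>dx/x - dx/(1 + x)\<close> and \<open>dx/(1 - x)\<close> becomes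
  \<open>dx/(1 + x)\<close>; the point 1 is mapped to 1/2.\<close>

primrec landen_words :: "nat \<Rightarrow> (real \<times> real list) list" where
  "landen_words 0 = [(1, [-1])]"
| "landen_words (Suc k) =
     map (\<lambda>(c, w). (c, 0 # w)) (landen_words k) @ map (\<lambda>(c, w). (- c, -1 # w)) (landen_words k)"

lemma landen_words_admissible: "(c, w) \<in> set (landen_words k) \<Longrightarrow> admissible w"
proof (induction k arbitrary: c w)
  case (Suc k)
  then obtain c' w' where "(c', w') \<in> set (landen_words k)" "w = 0 # w' \<or> w = -1 # w'"
    by auto
  with Suc.IH[of c' w'] show ?case by (elim disjE) (simp_all add: admissible_def)
qed (simp add: admissible_def)

lemma eval_iter_fps_0: "eval_fps (iter_fps (e # w)) 0 = 0"
  by (simp add: eval_fps_at_0)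

lemma has_real_derivative_sum_list:
  assumes "\<And>y. y \<in> set ys \<Longrightarrow> (f y has_real_derivative f' y) (at t)"
  shows "((\<lambda>x. \<Sum>y\<leftarrow>ys. f y x) has_real_derivative (\<Sum>y\<leftarrow>ys. f' y)) (at t)"
  using assms by (induction ys) (auto intro!: DERIV_add)

lemma eval_iter_fps_continuous:
  assumes "set w \<subseteq> {-1..1}" "\<bar>x\<bar> < 1"
  shows "isCont (eval_fps (iter_fps w)) x"
  using has_field_derivative_eval_fps[OF iter_fps_conv_radius_less[OF assms], of UNIV]
  by (rule DERIV_isCont)

text \<open>Both sides vanish at 0 and, by induction on k, have the same derivative. For k = 0 both
  are ln(1 + x).\<close>

theorem landen:
  assumes "0 \<le> x" "x < 1"
  shows "eval_fps (iter_fps (replicate k 0 @ [1])) (x / (1 + x)) =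
    (\<Sum>(c, w)\<leftarrow>landen_words k. c * eval_fps (iter_fps w) x)"
  using assms
proof (induction k arbitrary: x)
  have y': "((\<lambda>t. t / (1 + t)) has_real_derivative 1 / (1 + t)\<^sup>2) (at t)" if "0 < t" for t :: real
    using that by (auto intro!: derivative_eq_intros simp: field_simps power2_eq_square)
  have yc: "isCont (\<lambda>t. t / (1 + t)) t" if "0 \<le> t" for t :: real
    using that by (auto intro!: continuous_intros)
  \<comment> \<open>The form dx/x is singular at 0, so derivatives are compared for t > 0 only and
    continuity covers 0.\<close>
  have zero: "f x = 0" if "f 0 = 0" "\<And>t. 0 \<le> t \<Longrightarrow> t < 1 \<Longrightarrow> isCont f t"
    "\<And>t. 0 < t \<Longrightarrow> t < 1 \<Longrightarrow> (f has_real_derivative 0) (at t)" "0 \<le> x" "x < 1" for f :: "real \<Rightarrow> real" and x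
  proof (cases "x = 0")
    case False
    have "f x = f 0"
      using that False
      by (intro DERIV_isconst2[of 0 x]) (auto intro!: continuous_at_imp_continuous_on)
    with that show ?thesis by simp
  qed (use that in auto)
  {
    case 0
    let ?f = "\<lambda>t. eval_fps (iter_fps [1]) (t / (1 + t)) - eval_fps (iter_fps [-1]) t"
    have "?f x = 0"
    proof (rule zero[of ?f])
      show "?f 0 = 0" by (simp add: eval_iter_fps_0)
    next
      fix t :: real assume t: "0 \<le> t" "t < 1"
      then have "isCont (eval_fps (iter_fps [1])) (t / (1 + t))" "isCont (eval_fps (iter_fps [-1])) t"
        by (intro eval_iter_fps_continuous; simp)+
      then show "isCont ?f t"
        using t by (intro continuous_diff isCont_o2[OF yc])
    next
      fix t :: real assume t: "0 < t" "t < 1"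
      have "(eval_fps (iter_fps [1]) has_real_derivative 1 / (1 - t / (1 + t))) (at (t / (1 + t)))"
        using eval_iter_fps_deriv[of 1 "[]" "t / (1 + t)"] t by (simp add: iter_fps_Nil)
      moreover have "1 / (1 - t / (1 + t)) = 1 + t"
        using t by (simp add: field_simps)
      moreover have "(1 + t) * (1 / (1 + t)\<^sup>2) = 1 / (1 + t)"
        using t by (simp add: power2_eq_square)
      ultimately have "((\<lambda>t. eval_fps (iter_fps [1]) (t / (1 + t))) has_real_derivative 1 / (1 + t)) (at t)"
        using DERIV_chain2[OF _ y'[OF t(1)]] by metis
      moreover have "(eval_fps (iter_fps [-1]) has_real_derivative 1 / (1 + t)) (at t)"
        using eval_iter_fps_deriv[of "-1" "[]" t] t by (simp add: iter_fps_Nil)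
      ultimately show "(?f has_real_derivative 0) (at t)"
        by (auto intro!: derivative_eq_intros)
    qed (use 0 in auto)
    then show ?case by simp
  next
    case (Suc k)
    let ?w = "replicate k 0 @ [1]"
    let ?g = "\<lambda>t. \<Sum>(c, w)\<leftarrow>landen_words (Suc k). c * eval_fps (iter_fps w) t"
    let ?f = "\<lambda>t. eval_fps (iter_fps (0 # ?w)) (t / (1 + t)) - ?g t"
    have "?f x = 0"
    proof (rule zero[of ?f])
      have "?g 0 = (\<Sum>y\<leftarrow>landen_words (Suc k). 0)"
        by (intro arg_cong[where f = sum_list] map_cong) (auto simp: eval_iter_fps_0)
      then show "?f 0 = 0" by (simp add: eval_iter_fps_0 del: landen_words.simps)
    next
      fix t :: real assume t: "0 \<le> t" "t < 1"
      then have "isCont (eval_fps (iter_fps (0 # ?w))) (t / (1 + t))"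
        by (intro eval_iter_fps_continuous) (auto simp: set_replicate_conv_if)
      then have "isCont (\<lambda>t. eval_fps (iter_fps (0 # ?w)) (t / (1 + t))) t"
        using t by (intro isCont_o2[OF yc])
      moreover have "isCont ?g t"
        unfolding isCont_def
      proof (intro tendsto_sum_list)
        fix y assume "y \<in> set (landen_words (Suc k))"
        then have "set (snd y) \<subseteq> {-1..1}"
          using landen_words_admissible[of "fst y" "snd y" "Suc k"] by (simp add: admissible_def del: landen_words.simps)
        then have "isCont (eval_fps (iter_fps (snd y))) t"
          using t by (intro eval_iter_fps_continuous) auto
        then show "(\<lambda>x. case y of (c, w) \<Rightarrow> c * eval_fps (iter_fps w) x) \<midarrow>t\<rightarrow> (case y of (c, w) \<Rightarrow> c * eval_fps (iter_fps w) t)"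
          by (auto simp: isCont_def split_beta intro!: tendsto_intros)
      qed
      ultimately show "isCont ?f t" by (rule continuous_diff)
    next
      fix t :: real assume t: "0 < t" "t < 1"
      let ?S = "\<Sum>(c, w)\<leftarrow>landen_words k. c * eval_fps (iter_fps w) t"
      have "(eval_fps (iter_fps (0 # ?w)) has_real_derivative
          eval_fps (iter_fps ?w) (t / (1 + t)) / (t / (1 + t))) (at (t / (1 + t)))"
        using eval_iter_fps_deriv[of 0 ?w "t / (1 + t)"] t by (simp add: set_replicate_conv_if)
      also have "eval_fps (iter_fps ?w) (t / (1 + t)) = ?S"
        using t by (intro Suc.IH) auto
      finally have "((\<lambda>t. eval_fps (iter_fps (0 # ?w)) (t / (1 + t))) has_real_derivative
          ?S / (t / (1 + t)) * (1 / (1 + t)\<^sup>2)) (at t)"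
        using y'[OF t(1)] by (rule DERIV_chain2)
      \<comment> \<open>The partial fractions behind the two halves of
        \<open>landen_words (Suc k)\<close>.\<close>
      moreover have "a / (t / (1 + t)) * (1 / (1 + t)\<^sup>2) = a / t - a / (1 + t)" for a
        using t by (simp add: divide_simps power2_eq_square) (simp add: algebra_simps)
      moreover have "(?g has_real_derivative ?S / t - ?S / (1 + t)) (at t)"
      proof -
        have d: "((\<lambda>t. \<Sum>(c, w)\<leftarrow>landen_words k. c * eval_fps (iter_fps (e # w)) t) has_real_derivative
            (\<Sum>(c, w)\<leftarrow>landen_words k. c * (eval_fps (iter_fps w) t / (if e = 0 then t else 1 - e * t)))) (at t)"
          if "e \<in> {0, -1}" for e
        proof (intro has_real_derivative_sum_list)
          fix y assume "y \<in> set (landen_words k)"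
          then have "admissible (snd y)"
            using landen_words_admissible[of "fst y" "snd y"] by simp
          then have "(eval_fps (iter_fps (e # snd y)) has_real_derivative
              eval_fps (iter_fps (snd y)) t / (if e = 0 then t else 1 - e * t)) (at t)"
            using t that by (intro eval_iter_fps_deriv) (auto simp: admissible_def)
          then show "((\<lambda>x. case y of (c, w) \<Rightarrow> c * eval_fps (iter_fps (e # w)) x) has_real_derivative
              (case y of (c, w) \<Rightarrow> c * (eval_fps (iter_fps w) t / (if e = 0 then t else 1 - e * t)))) (at t)"
            unfolding split_beta by (rule DERIV_cmult)
        qed
        have s: "(\<Sum>(c, w)\<leftarrow>landen_words k. c * (eval_fps (iter_fps w) t / d)) = ?S / d" for d
          by (simp add: divide_inverse sum_list_mult_const [symmetric] case_prod_unfold mult.assoc)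
        have g: "?g = (\<lambda>t. (\<Sum>(c, w)\<leftarrow>landen_words k. c * eval_fps (iter_fps (0 # w)) t) -
            (\<Sum>(c, w)\<leftarrow>landen_words k. c * eval_fps (iter_fps (-1 # w)) t))"
          by (simp add: o_def case_prod_unfold diff_conv_add_uminus uminus_sum_list_map del: add_uminus_conv_diff)
        show ?thesis
          unfolding g using DERIV_diff[OF d[of 0] d[of "-1"]] by (simp add: s del: times_divide_eq_right)
      qed
      ultimately show "(?f has_real_derivative 0) (at t)"
        using DERIV_diff by fastforce
    qed (use Suc in auto)
    then show ?case by simp
  }
qed

text \<open>Let x tend to 1: on the left x / (1 + x) tends to 1/2, inside the disc, where continuity
  suffices; the words on the right reach the boundary and need Abel's theorem.\<close>

theorem polylog_half: "polylog (Suc k) (1 / 2) = (\<Sum>(c, w)\<leftarrow>landen_words k. c * iter_val w)"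
proof -
  let ?w = "replicate k 0 @ [1 :: real]"
  have "((\<lambda>x. \<Sum>(c, w)\<leftarrow>landen_words k. c * eval_fps (iter_fps w) x) \<longlongrightarrow>
     (\<Sum>(c, w)\<leftarrow>landen_words k. c * iter_val w)) (at_left 1)"
    using landen_words_admissible
    by (intro tendsto_sum_list) (auto simp: split_beta intro!: tendsto_mult eval_iter_fps_tendsto)
  then have "((\<lambda>x. eval_fps (iter_fps ?w) (x / (1 + x))) \<longlongrightarrow>
     (\<Sum>(c, w)\<leftarrow>landen_words k. c * iter_val w)) (at_left 1)"
    by (rule Lim_transform_eventually) (rule eventually_mono[OF eventually_at_left_1], simp add: landen)
  moreover have "((\<lambda>x. eval_fps (iter_fps ?w) (x / (1 + x))) \<longlongrightarrow> eval_fps (iter_fps ?w) (1 / (1 + 1))) (at_left 1)"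
    by (intro isCont_tendsto_compose[OF eval_iter_fps_continuous] tendsto_intros) (auto simp: set_replicate_conv_if)
  ultimately have "eval_fps (iter_fps ?w) (1 / (1 + 1)) = (\<Sum>(c, w)\<leftarrow>landen_words k. c * iter_val w)"
    by (intro tendsto_unique) (auto simp: trivial_limit_at_left_real)
  then show ?thesis by (simp add: polylog_eq_eval_iter_fps)
qed

section \<open>Harmonic sums as values of words\<close>

fun merge_index :: "nat \<times> real \<Rightarrow> (nat \<times> real) list \<Rightarrow> (nat \<times> real) list" where
  "merge_index a [] = [a]"
| "merge_index (s, \<sigma>) ((t, \<tau>) # z) = (s + t, \<sigma> * \<tau>) # z"

text \<open>A harmonic number includes the current index, whereas nested sums are strict. The top
  term of the inner sum shares its index with the outer factor, so the two merge into one
  entry.\<close>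

lemma nested_sum_nonstrict:
  assumes "z \<noteq> []"
  shows "(\<Sum>n<N. \<sigma> ^ Suc n / real (Suc n) ^ s * nested_sum z (Suc n)) =
    nested_sum ((s, \<sigma>) # z) N + nested_sum (merge_index (s, \<sigma>) z) N"
proof -
  obtain t \<tau> u where z: "z = (t, \<tau>) # u" using assms by (cases z) auto
  show ?thesis
    unfolding z by (induction N) (simp_all add: algebra_simps power_mult_distrib power_add)
qed

definition nonstrict_val :: "nat \<times> real \<Rightarrow> (nat \<times> real) list list \<Rightarrow> real" where
  "nonstrict_val a zs = (\<Sum>z\<leftarrow>zs. nested_val (a # z) + nested_val (merge_index a z))"

text \<open>Empty inner indices are excluded: they have no top term to merge, and
  \<open>nonstrict_val\<close> would count the outer sum twice.\<close>

definition convergent_nonstrict :: "nat \<times> real \<Rightarrow> (nat \<times> real) list list \<Rightarrow> bool" where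
  "convergent_nonstrict a zs \<longleftrightarrow>
     list_all (\<lambda>z. z \<noteq> [] \<and> convergent_index (a # z) \<and> convergent_index (merge_index a z)) zs"

lemma nested_sums_nonstrict:
  assumes "convergent_nonstrict (s, \<sigma>) zs"
  shows "(\<lambda>n. \<sigma> ^ Suc n / real (Suc n) ^ s * (\<Sum>z\<leftarrow>zs. nested_sum z (Suc n))) sums nonstrict_val (s, \<sigma>) zs"
  using assms unfolding nonstrict_val_def convergent_nonstrict_def
proof (induction zs)
  case (Cons z zs)
  have "(\<lambda>n. \<sigma> ^ Suc n / real (Suc n) ^ s * nested_sum z (Suc n)) sums
     (nested_val ((s, \<sigma>) # z) + nested_val (merge_index (s, \<sigma>) z))"
    using Cons.prems unfolding sums_def
    by (subst nested_sum_nonstrict; (intro tendsto_add nested_sum_tendsto)?) auto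
  from sums_add[OF this Cons.IH] Cons.prems show ?case
    by (simp add: distrib_left del: power_Suc of_nat_Suc)
qed simp

lemma nested_sum_list_stuffle:
  "(\<Sum>z\<leftarrow>zs. nested_sum z N) * nested_sum v N = (\<Sum>z\<leftarrow>concat (map (\<lambda>z. stuffle z v) zs). nested_sum z N)"
  by (induction zs) (simp_all add: distrib_right nested_sum_stuffle)

lemma gen_harm_eq: "gen_harm p N = nested_sum [(p, 1)] N"
  unfolding gen_harm_def by (simp add: sum.atLeast1_atMost_eq)

text \<open>\<open>alt_harm\<close> starts with a positive term, the nested sum with sign -1 with a
  negative one.\<close>

lemma alt_harm_eq: "alt_harm p N = - nested_sum [(p, -1)] N"
  unfolding alt_harm_def by (simp add: sum.atLeast1_atMost_eq sum_negf)

section \<open>Values in weight at most four\<close>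

abbreviation stuffle_list :: "(nat \<times> real) list list \<Rightarrow> (nat \<times> real) list \<Rightarrow> (nat \<times> real) list list" where
  "stuffle_list zs v \<equiv> concat (map (\<lambda>z. stuffle z v) zs)"

lemma replicate_numeral [simp]: "replicate (numeral k) x = x # replicate (pred_numeral k) x"
  by (simp add: numeral_eq_Suc)

lemma landen_words_numeral [simp]: "landen_words (numeral k) =
    map (\<lambda>(c, w). (c, 0 # w)) (landen_words (pred_numeral k)) @
    map (\<lambda>(c, w). (- c, -1 # w)) (landen_words (pred_numeral k))"
  by (simp add: numeral_eq_Suc)

lemmas relation_simps = admissible_def convergent_index_def nested_val_def

lemma iter_val_weight_2:
  "iter_val [0, 1] = zeta 2" "iter_val [0, -1] = 1/2 * zeta 2"
  "iter_val [-1, -1] = 1/2 * ln 2 ^ 2" "iter_val [-1, 1] = 1/2 * zeta 2 - 1/2 * ln 2 ^ 2"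
proof -
  have product: "iter_val [-1] * iter_val [-1] = ln 2 ^ 2"
    by (simp add: iter_val_neg1 power2_eq_square)
  show 1: "iter_val [0, 1] = zeta 2" using iter_val_eq_zeta[of 1] by simp
  show "iter_val [0, -1] = 1/2 * zeta 2" using iter_val_depth_1_neg1[of 1] 1 by simp
  note shuffle = iter_val_shuffle[of "[-1]" "[-1]"]
  show "iter_val [-1, -1] = 1/2 * ln 2 ^ 2"
    using shuffle [simplified relation_simps, simplified] product by linarith
  \<comment> \<open>The word of \<open>[(1, -1), (1, -1)]\<close> is \<open>[-1, 1]\<close>, its
    second letter being the product of both signs; its nested sign is -1.\<close>
  note stuffle = nested_val_stuffle[of "[(1, -1)]" "[(1, -1)]"]
  show "iter_val [-1, 1] = 1/2 * zeta 2 - 1/2 * ln 2 ^ 2"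
    using stuffle [simplified relation_simps, simplified] product 1 by linarith
qed

text \<open>These are all twelve admissible words of weight 3 in the letters -1, 0, 1. With the
  products evaluated, the relations are linear in them.\<close>

lemma iter_val_weight_3:
  "iter_val [0, 0, 1] = zeta 3"
  "iter_val [0, 0, -1] = 3/4 * zeta 3"
  "iter_val [0, 1, 1] = zeta 3"
  "iter_val [0, 1, -1] = -zeta 3 + 3/2 * (zeta 2 * ln 2)"
  "iter_val [0, -1, 1] = 13/8 * zeta 3 - 3/2 * (zeta 2 * ln 2)"
  "iter_val [0, -1, -1] = 1/8 * zeta 3"
  "iter_val [-1, 0, 1] = -5/8 * zeta 3 + zeta 2 * ln 2"
  "iter_val [-1, 0, -1] = -1/4 * zeta 3 + 1/2 * (zeta 2 * ln 2)"
  "iter_val [-1, 1, 1] = 7/8 * zeta 3 - 1/2 * (zeta 2 * ln 2) + 1/6 * ln 2 ^ 3"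
  "iter_val [-1, 1, -1] = -1/4 * zeta 3 + 1/2 * (zeta 2 * ln 2) - 1/6 * ln 2 ^ 3"
  "iter_val [-1, -1, 1] = 1/8 * zeta 3 - 1/6 * ln 2 ^ 3"
  "iter_val [-1, -1, -1] = 1/6 * ln 2 ^ 3"
proof -
  have products:
    "iter_val [-1] * iter_val [0, 1] = zeta 2 * ln 2"
    "iter_val [-1] * iter_val [0, -1] = 1/2 * (zeta 2 * ln 2)"
    "iter_val [-1] * iter_val [-1, 1] = 1/2 * (zeta 2 * ln 2) - 1/2 * ln 2 ^ 3"
    "iter_val [-1] * iter_val [-1, -1] = 1/2 * ln 2 ^ 3"
    by (simp_all add: iter_val_neg1 iter_val_weight_2 field_simps power2_eq_square power3_eq_cube)
  have 1: "iter_val [0, 0, 1] = zeta 3"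
    using iter_val_eq_zeta[of 2] by (simp add: numeral_eq_Suc)
  have 2: "iter_val [0, 0, -1] = 3/4 * zeta 3"
    using iter_val_depth_1_neg1[of 2] 1 by (simp add: numeral_eq_Suc)
  note shuffle = iter_val_shuffle[of "[-1]" "[0, 1]"] iter_val_shuffle[of "[-1]" "[0, -1]"]
    iter_val_shuffle[of "[-1]" "[-1, 1]"] iter_val_shuffle[of "[-1]" "[-1, -1]"]
  note stuffle = nested_val_stuffle[of "[(1, -1)]" "[(2, 1)]"] nested_val_stuffle[of "[(1, -1)]" "[(2, -1)]"]
    nested_val_stuffle[of "[(1, -1)]" "[(1, -1), (1, -1)]"] nested_val_stuffle[of "[(1, -1)]" "[(1, -1), (1, 1)]"]
  \<comment> \<open>The first instance is Euler's relation between \<open>iter_val [0, 1, 1]\<close>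
    and \<open>iter_val [0, 0, 1]\<close>.\<close>
  note regularized = regularized_double_shuffle[of 0 1 "[]"] regularized_double_shuffle[of 0 "-1" "[]"]
  note relations = shuffle [simplified relation_simps, simplified]
    stuffle [simplified relation_simps, simplified]
    regularized [simplified relation_simps, simplified] products 1 2
  show
    "iter_val [0, 0, 1] = zeta 3"
    "iter_val [0, 0, -1] = 3/4 * zeta 3"
    "iter_val [0, 1, 1] = zeta 3"
    "iter_val [0, 1, -1] = -zeta 3 + 3/2 * (zeta 2 * ln 2)"
    "iter_val [0, -1, 1] = 13/8 * zeta 3 - 3/2 * (zeta 2 * ln 2)"
    "iter_val [0, -1, -1] = 1/8 * zeta 3"
    "iter_val [-1, 0, 1] = -5/8 * zeta 3 + zeta 2 * ln 2"
    "iter_val [-1, 0, -1] = -1/4 * zeta 3 + 1/2 * (zeta 2 * ln 2)"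
    "iter_val [-1, 1, 1] = 7/8 * zeta 3 - 1/2 * (zeta 2 * ln 2) + 1/6 * ln 2 ^ 3"
    "iter_val [-1, 1, -1] = -1/4 * zeta 3 + 1/2 * (zeta 2 * ln 2) - 1/6 * ln 2 ^ 3"
    "iter_val [-1, -1, 1] = 1/8 * zeta 3 - 1/6 * ln 2 ^ 3"
    "iter_val [-1, -1, -1] = 1/6 * ln 2 ^ 3"
    using relations by linarith+
qed

text \<open>The outer entry (1, -1) carries (-1)^n instead of (-1)^(n-1). In the first four cases an
  odd number of factors \<open>alt_harm\<close> cancels this sign; the last two contain none and are
  negated.\<close>

lemma nonstrict_val_weight_4:
  "nonstrict_val (1, -1) (stuffle [(2, 1)] [(1, -1)]) =
    43/16 * zeta 4 - 1/4 * zeta 2 * ln 2 ^ 2 - 1/8 * ln 2 ^ 4 - 3 * polylog 4 (1/2)"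
  "nonstrict_val (1, -1) (stuffle_list (stuffle [(1, 1)] [(1, 1)]) [(1, -1)]) =
    53/16 * zeta 4 + 1/8 * ln 2 ^ 4 + 1/4 * zeta 2 * ln 2 ^ 2 - 3 * polylog 4 (1/2)"
  "nonstrict_val (1, -1) (stuffle_list (stuffle [(1, -1)] [(1, -1)]) [(1, -1)]) =
    5 * polylog 4 (1/2) - 59/16 * zeta 4 + 13/4 * zeta 2 * ln 2 ^ 2 + 11/24 * ln 2 ^ 4"
  "nonstrict_val (1, -1) (stuffle [(1, 1)] [(2, -1)]) =
    3 * polylog 4 (1/2) + 1/8 * ln 2 ^ 4 - 1/4 * zeta 2 * ln 2 ^ 2 - 9/16 * zeta 4"
  "nonstrict_val (1, -1) (stuffle [(1, 1)] [(2, 1)]) =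
    - (2 * polylog 4 (1/2) + 1/12 * ln 2 ^ 4 + 7/8 * zeta 3 * ln 2 - 1/4 * zeta 2 * ln 2 ^ 2 - zeta 4)"
  "nonstrict_val (1, -1) (stuffle_list (stuffle [(1, 1)] [(1, 1)]) [(1, 1)]) =
    - (5/8 * zeta 4 + 3/4 * zeta 2 * ln 2 ^ 2 - 1/4 * ln 2 ^ 4 - 9/8 * zeta 3 * ln 2)"
proof -
  \<comment> \<open>As rewrite rules these products make every relation below linear in the words of
    weight 4.\<close>
  have [simp]:
    "iter_val [-1] * iter_val [0, 0, 1] = zeta 3 * ln 2"
    "iter_val [-1] * iter_val [0, 0, -1] = 3/4 * (zeta 3 * ln 2)"
    "iter_val [-1] * iter_val [0, 1, 1] = zeta 3 * ln 2"
    "iter_val [-1] * iter_val [0, 1, -1] = - (zeta 3 * ln 2) + 3/2 * (zeta 2 * ln 2 ^ 2)"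
    "iter_val [-1] * iter_val [0, -1, -1] = 1/8 * (zeta 3 * ln 2)"
    "iter_val [-1] * iter_val [-1, 0, -1] = -1/4 * (zeta 3 * ln 2) + 1/2 * (zeta 2 * ln 2 ^ 2)"
    "iter_val [-1] * iter_val [-1, 1, -1] = -1/4 * (zeta 3 * ln 2) + 1/2 * (zeta 2 * ln 2 ^ 2) - 1/6 * ln 2 ^ 4"
    "iter_val [-1] * iter_val [-1, -1, -1] = 1/6 * ln 2 ^ 4"
    "iter_val [0, 1] * iter_val [0, 1] = zeta 2 ^ 2"
    "iter_val [0, 1] * iter_val [0, -1] = 1/2 * zeta 2 ^ 2"
    "iter_val [0, 1] * iter_val [-1, 1] = 1/2 * zeta 2 ^ 2 - 1/2 * (zeta 2 * ln 2 ^ 2)"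
    "iter_val [0, 1] * iter_val [-1, -1] = 1/2 * (zeta 2 * ln 2 ^ 2)"
    "iter_val [0, -1] * iter_val [0, -1] = 1/4 * zeta 2 ^ 2"
    "iter_val [0, -1] * iter_val [-1, -1] = 1/4 * (zeta 2 * ln 2 ^ 2)"
    "iter_val [-1, 1] * iter_val [-1, 1] = 1/4 * zeta 2 ^ 2 - 1/2 * (zeta 2 * ln 2 ^ 2) + 1/4 * ln 2 ^ 4"
    "iter_val [-1, -1] * iter_val [-1, -1] = 1/4 * ln 2 ^ 4"
    by (simp_all add: iter_val_neg1 iter_val_weight_2 iter_val_weight_3 field_simps
        power2_eq_square power3_eq_cube power4_eq_xxxx)
  \<comment> \<open>Gaussian elimination: every line solves one relation for a new value, with the values of
    \<open>iter_val [-1, 0, 0, 1]\<close>, \<open>iter_val [-1, 0, -1, -1]\<close>, \<open>iter_val [-1, 1, 1, 1]\<close> and \<open>zeta 2 ^ 2\<close>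
    serving as parameters until a relation determines them.\<close>
  have [simp]: "iter_val [0, 0, 0, 1] = zeta 4"
    using iter_val_eq_zeta[of 3] by simp
  have [simp]: "iter_val [-1, -1, -1, -1] = 1/24 * ln 2 ^ 4"
    using iter_val_shuffle[of "[-1]" "[-1, -1, -1]", simplified relation_simps, simplified]
    by linarith
  have [simp]: "iter_val [0, 0, 0, -1] = 7/8 * zeta 4"
    using iter_val_depth_1_neg1[of 3] by simp
  have [simp]: "iter_val [0, 0, -1, 1] = zeta 4 - 3/4 * (zeta 3 * ln 2) - iter_val [-1, 0, 0, 1]"
    using nested_val_stuffle[of "[(1, -1)]" "[(3, -1)]", simplified relation_simps, simplified]
    by linarith
  have [simp]: "iter_val [0, 1, 0, 1] = -1/2 * zeta 4 + 1/2 * zeta 2 ^ 2"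
    using nested_val_stuffle[of "[(2, 1)]" "[(2, 1)]", simplified relation_simps, simplified]
    by linarith
  have [simp]: "iter_val [0, 0, 1, 1] = 1/4 * zeta 4"
    using iter_val_shuffle[of "[0, 1]" "[0, 1]", simplified relation_simps, simplified]
    by linarith
  have [simp]: "iter_val [0, 1, 1, 1] = -1/4 * zeta 4 + 1/2 * zeta 2 ^ 2"
    using regularized_double_shuffle[of 0 "1" "[(1, 1)]", simplified relation_simps, simplified]
    by linarith
  have [simp]: "iter_val [0, -1, 0, 1] = 1/2 * zeta 4 - 1/8 * zeta 2 ^ 2"
    using nested_val_stuffle[of "[(2, -1)]" "[(2, -1)]", simplified relation_simps, simplified]
    by linarith
  have [simp]: "iter_val [0, 0, 1, -1] = -3/2 * zeta 4 + 1/8 * zeta 2 ^ 2 + 7/4 * (zeta 3 * ln 2)"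
    using iter_val_shuffle[of "[-1]" "[0, 0, 1]", simplified relation_simps, simplified]
    by linarith
  have [simp]: "iter_val [0, 1, 0, -1] = 1/2 * zeta 4 + 3/8 * zeta 2 ^ 2 - 2 * (zeta 3 * ln 2) + 2 * iter_val [-1, 0, 0, 1]"
    using iter_val_shuffle[of "[0, 1]" "[0, -1]", simplified relation_simps, simplified]
    by linarith
  have [simp]: "iter_val [-1, 0, 0, -1] = -5/8 * zeta 4 + 1/8 * zeta 2 ^ 2 + 3/4 * (zeta 3 * ln 2)"
    using nested_val_stuffle[of "[(1, -1)]" "[(3, 1)]", simplified relation_simps, simplified]
    by linarith
  have [simp]: "iter_val [0, -1, 0, -1] = 11/8 * zeta 4 - 1/8 * zeta 2 ^ 2 - 2 * (zeta 3 * ln 2) + 2 * iter_val [-1, 0, 0, 1]"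
    using nested_val_stuffle[of "[(2, 1)]" "[(2, -1)]", simplified relation_simps, simplified]
    by linarith
  have [simp]: "iter_val [0, 0, -1, -1] = 7/8 * zeta 4 - 1/2 * zeta 2 ^ 2 + zeta 3 * ln 2 - iter_val [-1, 0, 0, 1]"
    using regularized_double_shuffle[of "Suc 0" "-1" "[]", simplified relation_simps, simplified]
    by linarith
  \<comment> \<open>The ratio that follows from Euler's evaluations of zeta(2) and zeta(4), obtained
    here without them.\<close>
  have [simp]: "zeta 2 ^ 2 = 5/2 * zeta 4"
    using iter_val_shuffle[of "[-1]" "[0, 0, -1]", simplified relation_simps, simplified]
    by linarith
  have [simp]: "iter_val [0, -1, -1, -1] = 1/24 * (zeta 3 * ln 2) - 1/3 * iter_val [-1, 0, -1, -1]"
    using iter_val_shuffle[of "[-1]" "[0, -1, -1]", simplified relation_simps, simplified]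
    by linarith
  have [simp]: "iter_val [-1, -1, 0, -1] = -1/8 * (zeta 3 * ln 2) + 1/4 * (zeta 2 * ln 2 ^ 2) - iter_val [-1, 0, -1, -1]"
    using iter_val_shuffle[of "[0, -1]" "[-1, -1]", simplified relation_simps, simplified]
    by linarith
  have [simp]: "iter_val [0, 1, -1, -1] = 11/16 * zeta 4 - 15/8 * (zeta 3 * ln 2) + 3/4 * (zeta 2 * ln 2 ^ 2) + iter_val [-1, 0, 0, 1]"
    using nested_val_stuffle[of "[(2, 1)]" "[(1, -1), (1, 1)]", simplified relation_simps, simplified]
    by linarith
  \<comment> \<open>The only relation that introduces Li_4(1/2): the eight words of
    \<open>landen_words 3\<close>.\<close>
  have [simp]: "iter_val [-1, 0, -1, -1] = 3/2 * zeta 4 + 1/2 * (zeta 3 * ln 2) + 3/4 * (zeta 2 * ln 2 ^ 2) - 1/8 * ln 2 ^ 4 - 3 * polylog 4 (1/2) - 3 * iter_val [-1, 0, 0, 1]"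
    using polylog_half[of 3, simplified]
    by linarith
  have [simp]: "iter_val [0, 1, 1, -1] = -21/8 * zeta 4 + 13/8 * (zeta 3 * ln 2) + 1/8 * ln 2 ^ 4 + 3 * polylog 4 (1/2) + iter_val [-1, 0, 0, 1]"
    using nested_val_stuffle[of "[(1, -1)]" "[(2, 1), (1, 1)]", simplified relation_simps, simplified]
    by linarith
  have [simp]: "iter_val [0, 1, -1, 1] = 35/16 * zeta 4 - 3/4 * (zeta 2 * ln 2 ^ 2) - 1/8 * ln 2 ^ 4 - 3 * polylog 4 (1/2)"
    using regularized_double_shuffle[of 0 "1" "[(1, -1)]", simplified relation_simps, simplified]
    by linarith
  have [simp]: "iter_val [-1, 0, -1, 1] = 37/8 * zeta 4 - 7/4 * (zeta 3 * ln 2) - 1/4 * ln 2 ^ 4 - 6 * polylog 4 (1/2) - iter_val [-1, 0, 0, 1]"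
    using nested_val_stuffle[of "[(1, -1)]" "[(2, 1), (1, -1)]", simplified relation_simps, simplified]
    by linarith
  have [simp]: "iter_val [-1, 1, 0, 1] = 43/16 * zeta 4 - zeta 3 * ln 2 + 1/4 * (zeta 2 * ln 2 ^ 2) - 1/8 * ln 2 ^ 4 - 3 * polylog 4 (1/2) - iter_val [-1, 0, 0, 1]"
    using nested_val_stuffle[of "[(1, -1)]" "[(1, -1), (2, 1)]", simplified relation_simps, simplified]
    by linarith
  have [simp]: "iter_val [-1, 1, -1, 1] = 1/16 * zeta 4 + 1/4 * (zeta 3 * ln 2) - 1/4 * (zeta 2 * ln 2 ^ 2) + 1/24 * ln 2 ^ 4"
    using nested_val_stuffle[of "[(1, -1)]" "[(1, -1), (1, -1), (1, -1)]", simplified relation_simps, simplified]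
    by linarith
  have [simp]: "iter_val [-1, -1, 1, 1] = 1/8 * zeta 4 - 1/8 * (zeta 3 * ln 2) + 1/24 * ln 2 ^ 4"
    using iter_val_shuffle[of "[-1, 1]" "[-1, 1]", simplified relation_simps, simplified]
    by linarith
  have [simp]: "iter_val [-1, 0, 1, 1] = -19/16 * zeta 4 + 7/8 * (zeta 3 * ln 2) - 1/4 * (zeta 2 * ln 2 ^ 2) + 1/24 * ln 2 ^ 4 + 3 * polylog 4 (1/2) + iter_val [-1, 0, 0, 1] - 2 * iter_val [-1, 1, 1, 1]"
    using nested_val_stuffle[of "[(1, -1), (1, 1)]" "[(1, -1), (1, 1)]", simplified relation_simps, simplified]
    by linarith
  have [simp]: "iter_val [0, -1, 1, 1] = -5/8 * zeta 4 - 3/8 * (zeta 3 * ln 2) + 1/4 * (zeta 2 * ln 2 ^ 2) + 1/12 * ln 2 ^ 4 - 1/2 * iter_val [-1, 0, 0, 1] + 2 * iter_val [-1, 1, 1, 1]"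
    using iter_val_shuffle[of "[0, 1]" "[-1, 1]", simplified relation_simps, simplified]
    by linarith
  have [simp]: "iter_val [0, -1, -1, 1] = -15/8 * zeta 4 + 3/8 * (zeta 3 * ln 2) + 1/8 * ln 2 ^ 4 + 3 * polylog 4 (1/2) + 1/2 * iter_val [-1, 0, 0, 1]"
    using nested_val_stuffle[of "[(1, -1)]" "[(2, -1), (1, 1)]", simplified relation_simps, simplified]
    by linarith
  have [simp]: "iter_val [-1, -1, 0, 1] = -33/16 * zeta 4 + 1/2 * (zeta 3 * ln 2) - 1/4 * (zeta 2 * ln 2 ^ 2) + 1/8 * ln 2 ^ 4 + 3 * polylog 4 (1/2) + 3/2 * iter_val [-1, 0, 0, 1]"
    using nested_val_stuffle[of "[(2, -1)]" "[(1, -1), (1, 1)]", simplified relation_simps, simplified]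
    by linarith
  have [simp]: "iter_val [-1, -1, -1, 1] = 1/4 * zeta 4 - 1/2 * (zeta 3 * ln 2) - 1/24 * ln 2 ^ 4 + 1/2 * iter_val [-1, 0, 0, 1]"
    using nested_val_stuffle[of "[(1, -1)]" "[(1, -1), (1, 1), (1, 1)]", simplified relation_simps, simplified]
    by linarith
  have [simp]: "iter_val [-1, 0, 0, 1] = 3/2 * zeta 4 - 3/4 * (zeta 3 * ln 2) + 1/2 * (zeta 2 * ln 2 ^ 2) - 1/12 * ln 2 ^ 4 - 2 * polylog 4 (1/2)"
    using iter_val_shuffle[of "[-1]" "[0, 1, 1]", simplified relation_simps, simplified]
    by linarith
  \<comment> \<open>A check on the value: with u = 1 - x this is the integral of (-ln u)^3 / (6 (2 -
    u)) over [0, 1], and expanding in powers of u/2 gives Li_4(1/2).\<close>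
  have [simp]: "iter_val [-1, 1, 1, 1] = polylog 4 (1/2)"
    using regularized_double_shuffle[of 0 "-1" "[(1, -1)]", simplified relation_simps, simplified]
    by linarith
  show "nonstrict_val (1, -1) (stuffle [(2, 1)] [(1, -1)]) =
    43/16 * zeta 4 - 1/4 * zeta 2 * ln 2 ^ 2 - 1/8 * ln 2 ^ 4 - 3 * polylog 4 (1/2)"
    by (simp add: nonstrict_val_def relation_simps add_divide_distrib diff_divide_distrib, linarith?)
  show "nonstrict_val (1, -1) (stuffle_list (stuffle [(1, 1)] [(1, 1)]) [(1, -1)]) =
    53/16 * zeta 4 + 1/8 * ln 2 ^ 4 + 1/4 * zeta 2 * ln 2 ^ 2 - 3 * polylog 4 (1/2)"
    by (simp add: nonstrict_val_def relation_simps add_divide_distrib diff_divide_distrib, linarith?)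
  show "nonstrict_val (1, -1) (stuffle_list (stuffle [(1, -1)] [(1, -1)]) [(1, -1)]) =
    5 * polylog 4 (1/2) - 59/16 * zeta 4 + 13/4 * zeta 2 * ln 2 ^ 2 + 11/24 * ln 2 ^ 4"
    by (simp add: nonstrict_val_def relation_simps add_divide_distrib diff_divide_distrib, linarith?)
  show "nonstrict_val (1, -1) (stuffle [(1, 1)] [(2, -1)]) =
    3 * polylog 4 (1/2) + 1/8 * ln 2 ^ 4 - 1/4 * zeta 2 * ln 2 ^ 2 - 9/16 * zeta 4"
    by (simp add: nonstrict_val_def relation_simps add_divide_distrib diff_divide_distrib, linarith?)
  show "nonstrict_val (1, -1) (stuffle [(1, 1)] [(2, 1)]) =
    - (2 * polylog 4 (1/2) + 1/12 * ln 2 ^ 4 + 7/8 * zeta 3 * ln 2 - 1/4 * zeta 2 * ln 2 ^ 2 - zeta 4)"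
    by (simp add: nonstrict_val_def relation_simps add_divide_distrib diff_divide_distrib, linarith?)
  show "nonstrict_val (1, -1) (stuffle_list (stuffle [(1, 1)] [(1, 1)]) [(1, 1)]) =
    - (5/8 * zeta 4 + 3/4 * zeta 2 * ln 2 ^ 2 - 1/4 * ln 2 ^ 4 - 9/8 * zeta 3 * ln 2)"
    by (simp add: nonstrict_val_def relation_simps add_divide_distrib diff_divide_distrib, linarith?)
qed

section \<open>The six series\<close>

lemma harmonic_sums_2:
  assumes "convergent_nonstrict (1, -1) (stuffle u v)"
  shows "(\<lambda>n. nested_sum u (Suc n) * nested_sum v (Suc n) / real (Suc n) * (-1) ^ n) sums
    - nonstrict_val (1, -1) (stuffle u v)"
  using sums_minus[OF nested_sums_nonstrict[OF assms]]
  unfolding nested_sum_stuffle [symmetric] by (simp add: field_simps del: of_nat_Suc)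

lemma harmonic_sums_3:
  assumes "convergent_nonstrict (1, -1) (stuffle_list (stuffle u v) t)"
  shows "(\<lambda>n. nested_sum u (Suc n) * nested_sum v (Suc n) * nested_sum t (Suc n) / real (Suc n) * (-1) ^ n) sums
    - nonstrict_val (1, -1) (stuffle_list (stuffle u v) t)"
  using sums_minus[OF nested_sums_nonstrict[OF assms]]
  unfolding nested_sum_stuffle nested_sum_list_stuffle [symmetric] by (simp add: field_simps del: of_nat_Suc)

theorem mainTheorem1:
  shows
    "(\<lambda>n. gen_harm 2 (Suc n) * alt_harm 1 (Suc n) / real (Suc n) * (-1) ^ n) sums
       (43/16 * zeta 4 - 1/4 * zeta 2 * ln 2 ^ 2 - 1/8 * ln 2 ^ 4 - 3 * polylog 4 (1/2))
   \<and> (\<lambda>n. gen_harm 1 (Suc n) ^ 2 * alt_harm 1 (Suc n) / real (Suc n) * (-1) ^ n) sums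
       (53/16 * zeta 4 + 1/8 * ln 2 ^ 4 + 1/4 * zeta 2 * ln 2 ^ 2 - 3 * polylog 4 (1/2))
   \<and> (\<lambda>n. alt_harm 1 (Suc n) ^ 3 / real (Suc n) * (-1) ^ n) sums
       (5 * polylog 4 (1/2) - 59/16 * zeta 4 + 13/4 * zeta 2 * ln 2 ^ 2 + 11/24 * ln 2 ^ 4)
   \<and> (\<lambda>n. gen_harm 1 (Suc n) * alt_harm 2 (Suc n) / real (Suc n) * (-1) ^ n) sums
       (3 * polylog 4 (1/2) + 1/8 * ln 2 ^ 4 - 1/4 * zeta 2 * ln 2 ^ 2 - 9/16 * zeta 4)
   \<and> (\<lambda>n. gen_harm 1 (Suc n) * gen_harm 2 (Suc n) / real (Suc n) * (-1) ^ n) sums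
       (2 * polylog 4 (1/2) + 1/12 * ln 2 ^ 4 + 7/8 * zeta 3 * ln 2 - 1/4 * zeta 2 * ln 2 ^ 2 - zeta 4)
   \<and> (\<lambda>n. gen_harm 1 (Suc n) ^ 3 / real (Suc n) * (-1) ^ n) sums
       (5/8 * zeta 4 + 3/4 * zeta 2 * ln 2 ^ 2 - 1/4 * ln 2 ^ 4 - 9/8 * zeta 3 * ln 2)"
proof -
  note conv = convergent_nonstrict_def convergent_index_def
  note sums2 = harmonic_sums_2[where u = "[(2, 1)]" and v = "[(1, -1)]"]
    harmonic_sums_2[where u = "[(1, 1)]" and v = "[(2, -1)]"]
    harmonic_sums_2[where u = "[(1, 1)]" and v = "[(2, 1)]"]
  note sums3 = harmonic_sums_3[where u = "[(1, 1)]" and v = "[(1, 1)]" and t = "[(1, -1)]"]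
    harmonic_sums_3[where u = "[(1, -1)]" and v = "[(1, -1)]" and t = "[(1, -1)]"]
    harmonic_sums_3[where u = "[(1, 1)]" and v = "[(1, 1)]" and t = "[(1, 1)]"]
  \<comment> \<open>The extra negations account for the factors \<open>alt_harm\<close> in the first
    four series.\<close>
  note sums = sums2(1) [THEN sums_minus] sums3(1,2) [THEN sums_minus] sums2(2) [THEN sums_minus] sums2(3) sums3(3)
  show ?thesis
    unfolding power2_eq_square power3_eq_cube gen_harm_eq alt_harm_eq
    using sums [unfolded nonstrict_val_weight_4 minus_minus power2_eq_square]
    by (simp add: conv del: nested_sum.simps of_nat_Suc)
qed

end
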